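(* Let $\mathfrak{q}$ be an $n\times n$ quantum parameter matrix over a field $k$ and $V$ a $k$-vector space with basis $v_1,\dots,v_n$. Let $\mathcal{P}$ be the partition of $[n]$ into the equivalence classes of $\mathcal{R}$. Then $$\mathrm{Aut}_{\mathrm{gr}}(S_{\mathfrak{q}}(V))\ \cong\ \prod_{D\in\mathcal{P}}\mathrm{Aut}_{\mathrm{gr}}\big(S_{\mathfrak{q}_{DD}}(V_D)\big).$$
   Context: An $n\times n$ quantum parameter matrix is a matrix $\mathfrak{q}=(q_{ij})$ over $k$ with $q_{ii}=1$ and $q_{ij}q_{ji}=1$ for all $i,j$. $S_{\mathfrak{q}}(V)$ is the $k$-algebra generated by $v_1,\dots,v_n$ with relations $v_jv_i=q_{ij}v_iv_j$, graded by $\deg v_i=1$; $\mathrm{Aut}_{\mathrm{gr}}$ denotes the group of degree-preserving algebra automorphisms. For $D\subseteq[n]$, $V_D=\mathrm{span}\{v_i:i\in D\}$ and $\mathfrak{q}_{DD}=(q_{ij})_{i,j\in D}$, a quantum parameter matrix defining $S_{\mathfrak{q}_{DD}}(V_D)$ with respect to $\{v_i:i\in D\}$. Define a relation on $[n]$ by $i\to\ell$ whenever there is a chain $i=i_0,i_1,\dots,i_p=\ell$ ($p\ge0$) such that for every $1\le s\le p$ either (1) row $i_{s-1}$ of $\mathfrak{q}$ is a permutation of row $i_s$ (as a sequence of entries), or (2) $q_{i_{s-1}i_s}\ne q_{i_ti_s}$ for some $0\le t<s$. $\mathcal{R}$ is the equivalence relation on $[n]$ generated by this relation. *)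

theory Defs
  imports "HOL-Algebra.Product_Groups" "HOL-Combinatorics.Permutations"
begin

definition qpm :: "nat \<Rightarrow> (nat \<Rightarrow> nat \<Rightarrow> 'k::field) \<Rightarrow> bool" where
  "qpm n q \<longleftrightarrow> (\<forall>i\<in>{1..n}. q i i = 1) \<and> (\<forall>i\<in>{1..n}. \<forall>j\<in>{1..n}. q i j * q j i = 1)"

text \<open>The quantum symmetric algebra on generators v_i, i in a finite index set I, with
  relations v_j v_i = q i j v_i v_j, realised on its PBW basis of ordered monomials
  v_{i_1}^{a_{i_1}} ... v_{i_m}^{a_{i_m}} (i_1 < ... < i_m), monomials encoded by exponent
  functions a supported in I.  An element is a finitely supported coefficient function.\<close>
definition qcarrier :: "nat set \<Rightarrow> ((nat \<Rightarrow> nat) \<Rightarrow> 'k::field) set" where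
  "qcarrier I = {f. finite {a. f a \<noteq> 0} \<and> (\<forall>a. f a \<noteq> 0 \<longrightarrow> (\<forall>i. i \<notin> I \<longrightarrow> a i = 0))}"

text \<open>Twist factor: (v^a)(v^b) = qtwist (v^(a+b)), from moving v_j^{b_j} past v_i^{a_i} for j < i,
  using v_i v_j = q j i v_j v_i.\<close>
definition qtwist :: "nat set \<Rightarrow> (nat \<Rightarrow> nat \<Rightarrow> 'k::field) \<Rightarrow> (nat \<Rightarrow> nat) \<Rightarrow> (nat \<Rightarrow> nat) \<Rightarrow> 'k" where
  "qtwist I q a b = (\<Prod>(i,j)\<in>{(i,j). i \<in> I \<and> j \<in> I \<and> j < i}. q j i ^ (a i * b j))"

definition qmult :: "nat set \<Rightarrow> (nat \<Rightarrow> nat \<Rightarrow> 'k::field) \<Rightarrow>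
    ((nat \<Rightarrow> nat) \<Rightarrow> 'k) \<Rightarrow> ((nat \<Rightarrow> nat) \<Rightarrow> 'k) \<Rightarrow> ((nat \<Rightarrow> nat) \<Rightarrow> 'k)" where
  "qmult I q f g = (\<lambda>c. if (\<forall>i. i \<notin> I \<longrightarrow> c i = 0) then
      (\<Sum>a\<in>{a. (\<forall>i. a i \<le> c i) \<and> (\<forall>i. i \<notin> I \<longrightarrow> a i = 0)}.
         f a * g (\<lambda>i. c i - a i) * qtwist I q a (\<lambda>i. c i - a i)) else 0)"

definition qone :: "(nat \<Rightarrow> nat) \<Rightarrow> 'k::field" where
  "qone = (\<lambda>a. if a = (\<lambda>_. 0) then 1 else 0)"

definition qdeg :: "nat set \<Rightarrow> (nat \<Rightarrow> nat) \<Rightarrow> nat" where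
  "qdeg I a = (\<Sum>i\<in>I. a i)"

definition qhomog :: "nat set \<Rightarrow> nat \<Rightarrow> ((nat \<Rightarrow> nat) \<Rightarrow> 'k::field) \<Rightarrow> bool" where
  "qhomog I d f \<longleftrightarrow> (\<forall>a. f a \<noteq> 0 \<longrightarrow> qdeg I a = d)"

definition qgraut :: "nat set \<Rightarrow> (nat \<Rightarrow> nat \<Rightarrow> 'k::field) \<Rightarrow>
    (((nat \<Rightarrow> nat) \<Rightarrow> 'k) \<Rightarrow> ((nat \<Rightarrow> nat) \<Rightarrow> 'k)) set" where
  "qgraut I q = {\<phi>. \<phi> \<in> extensional (qcarrier I) \<and> bij_betw \<phi> (qcarrier I) (qcarrier I)
     \<and> (\<forall>f\<in>qcarrier I. \<forall>g\<in>qcarrier I. \<phi> (\<lambda>a. f a + g a) = (\<lambda>a. \<phi> f a + \<phi> g a))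
     \<and> (\<forall>c. \<forall>f\<in>qcarrier I. \<phi> (\<lambda>a. c * f a) = (\<lambda>a. c * \<phi> f a))
     \<and> (\<forall>f\<in>qcarrier I. \<forall>g\<in>qcarrier I. \<phi> (qmult I q f g) = qmult I q (\<phi> f) (\<phi> g))
     \<and> \<phi> qone = qone
     \<and> (\<forall>d. \<forall>f\<in>qcarrier I. qhomog I d f \<longrightarrow> qhomog I d (\<phi> f))}"

definition Aut_gr :: "nat set \<Rightarrow> (nat \<Rightarrow> nat \<Rightarrow> 'k::field) \<Rightarrow>
    (((nat \<Rightarrow> nat) \<Rightarrow> 'k) \<Rightarrow> ((nat \<Rightarrow> nat) \<Rightarrow> 'k)) monoid" where
  "Aut_gr I q = \<lparr>carrier = qgraut I q, monoid.mult = (\<lambda>\<phi> \<psi>. compose (qcarrier I) \<phi> \<psi>),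
     monoid.one = restrict id (qcarrier I)\<rparr>"

definition row_perm :: "nat \<Rightarrow> (nat \<Rightarrow> nat \<Rightarrow> 'k) \<Rightarrow> nat \<Rightarrow> nat \<Rightarrow> bool" where
  "row_perm n q i j \<longleftrightarrow> (\<exists>\<sigma>. \<sigma> permutes {1..n} \<and> (\<forall>m\<in>{1..n}. q i (\<sigma> m) = q j m))"

definition qarrow :: "nat \<Rightarrow> (nat \<Rightarrow> nat \<Rightarrow> 'k) \<Rightarrow> nat \<Rightarrow> nat \<Rightarrow> bool" where
  "qarrow n q i l \<longleftrightarrow> (\<exists>xs. xs \<noteq> [] \<and> hd xs = i \<and> last xs = l \<and> set xs \<subseteq> {1..n} \<and>
     (\<forall>s. 1 \<le> s \<and> s < length xs \<longrightarrow>
        row_perm n q (xs ! (s - 1)) (xs ! s) \<or>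
        (\<exists>t<s. q (xs ! (s - 1)) (xs ! s) \<noteq> q (xs ! t) (xs ! s))))"

definition qR :: "nat \<Rightarrow> (nat \<Rightarrow> nat \<Rightarrow> 'k) \<Rightarrow> (nat \<times> nat) set" where
  "qR n q = (let A = {(i,l). i \<in> {1..n} \<and> l \<in> {1..n} \<and> qarrow n q i l}
             in Id_on {1..n} \<union> (A \<union> A\<inverse>)\<^sup>+)"

end

theory Submission
  imports Defs
begin

text \<open>A graded automorphism \<open>\<phi>\<close> is determined by its matrix in degree one.  If \<open>v_a\<close> occurs in
  \<open>\<phi> v_i\<close>, then for every scalar \<open>l\<close> the independent vectors \<open>\<phi> v_j\<close> with \<open>q i j = l\<close> all
  \<open>l\<close>-commute with \<open>\<phi> v_i\<close>, and this forces them to remain independent after projection to the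
  coordinates \<open>b\<close> with \<open>q a b = l\<close>.  Counting dimensions for all \<open>l\<close>, row \<open>a\<close> is a permutation
  of row \<open>i\<close>, so \<open>\<phi>\<close> preserves the subalgebra of every block and restriction to the blocks is an
  injective homomorphism.  Conversely, condition (2) makes \<open>q a b\<close> independent of \<open>a\<close> in a block
  \<open>D\<close> when \<open>b\<close> lies outside \<open>D\<close>, so a monomial outside \<open>D\<close> commutes with an element of degree
  \<open>m\<close> of the block up to a scalar depending only on \<open>m\<close>.  Hence a graded automorphism of one block,
  extended by the identity on the other generators, is an automorphism of the whole algebra, and
  composing these extensions gives surjectivity.\<close>

section \<open>Exponent vectors and finitely supported coefficient functions\<close>

definition supported_in :: "nat set \<Rightarrow> (nat \<Rightarrow> nat) \<Rightarrow> bool" where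
  "supported_in I a \<longleftrightarrow> (\<forall>i. i \<notin> I \<longrightarrow> a i = 0)"

definition qmono :: "(nat \<Rightarrow> nat) \<Rightarrow> (nat \<Rightarrow> nat) \<Rightarrow> 'k::field" where
  "qmono a = (\<lambda>b. if b = a then 1 else 0)"

definition unit_exp :: "nat \<Rightarrow> nat \<Rightarrow> nat" where
  "unit_exp i = (\<lambda>j. if j = i then 1 else 0)"

abbreviation qgen :: "nat \<Rightarrow> (nat \<Rightarrow> nat) \<Rightarrow> 'k::field" where
  "qgen i \<equiv> qmono (unit_exp i)"

lemma supported_in_mono: "supported_in D a \<Longrightarrow> D \<subseteq> I \<Longrightarrow> supported_in I a"
  by (auto simp: supported_in_def)

lemma supported_in_zero [simp]: "supported_in I (\<lambda>_. 0)"
  by (simp add: supported_in_def)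

lemma supported_in_disjoint:
  "\<lbrakk>supported_in X a; supported_in Y a; X \<inter> Y = {}\<rbrakk> \<Longrightarrow> a = (\<lambda>_. 0)"
  by (auto simp: supported_in_def fun_eq_iff)

lemma supported_in_add [simp]:
  "supported_in I (\<lambda>i. a i + b i) \<longleftrightarrow> supported_in I a \<and> supported_in I b"
  by (auto simp: supported_in_def)

lemma supported_in_diff: "supported_in I a \<Longrightarrow> supported_in I (\<lambda>i. a i - b i)"
  by (auto simp: supported_in_def)

lemma supported_in_le: "supported_in I c \<Longrightarrow> (\<And>i. a i \<le> c i) \<Longrightarrow> supported_in I a"
  unfolding supported_in_def by (metis le_zero_eq)

lemma supported_in_unit_exp [simp]: "supported_in I (unit_exp i) \<longleftrightarrow> i \<in> I"
  by (auto simp: supported_in_def unit_exp_def)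

lemma unit_exp_inject [simp]: "unit_exp i = unit_exp j \<longleftrightarrow> i = j"
  by (auto simp: unit_exp_def fun_eq_iff split: if_splits)

lemma qcarrier_iff:
  "f \<in> qcarrier I \<longleftrightarrow> finite {a. f a \<noteq> 0} \<and> (\<forall>a. f a \<noteq> 0 \<longrightarrow> supported_in I a)"
  by (simp add: qcarrier_def supported_in_def)

lemma qcarrier_eq_0: "f \<in> qcarrier I \<Longrightarrow> \<not> supported_in I a \<Longrightarrow> f a = 0"
  by (auto simp: qcarrier_iff)

lemma qcarrier_mono: "D \<subseteq> I \<Longrightarrow> qcarrier D \<subseteq> qcarrier I"
  unfolding subset_iff qcarrier_iff using supported_in_mono by blast

lemma qcarrier_add:
  assumes "f \<in> qcarrier I" "g \<in> qcarrier I"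
  shows "(\<lambda>a. f a + g a) \<in> qcarrier I"
proof -
  have "{a. f a + g a \<noteq> 0} \<subseteq> {a. f a \<noteq> 0} \<union> {a. g a \<noteq> 0}" by auto
  then show ?thesis
    using assms unfolding qcarrier_iff
    by (metis (no_types, lifting) add.right_neutral finite_UnI finite_subset)
qed

lemma qcarrier_scale: "f \<in> qcarrier I \<Longrightarrow> (\<lambda>a. s a * f a) \<in> qcarrier I"
  by (auto simp: qcarrier_iff elim!: rev_finite_subset)

lemma qcarrier_zero [simp]: "(\<lambda>_. 0) \<in> qcarrier I"
  by (simp add: qcarrier_iff)

lemma qmono_in_qcarrier [simp]: "qmono a \<in> qcarrier I \<longleftrightarrow> supported_in I a"
  by (auto simp: qcarrier_iff qmono_def)

lemma qone_eq_qmono: "qone = qmono (\<lambda>_. 0)"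
  by (simp add: qone_def qmono_def fun_eq_iff)

lemma qone_in_qcarrier [simp]: "qone \<in> qcarrier I"
  by (simp add: qone_eq_qmono)

lemma qcarrier_sum:
  assumes "finite S" "\<And>b. b \<in> S \<Longrightarrow> F b \<in> qcarrier I"
  shows "(\<lambda>c. \<Sum>b\<in>S. F b c) \<in> qcarrier I"
  using assms by (induction S rule: finite_induct) (auto intro: qcarrier_add)

text \<open>Linear statements need only be checked on monomials: a finitely supported function is
  taken apart one monomial at a time, by induction on its support.\<close>

lemma qcarrier_induct [consumes 1, case_names mono add scale]:
  assumes f: "f \<in> qcarrier I"
    and mono: "\<And>a. supported_in I a \<Longrightarrow> P (qmono a)"
    and add: "\<And>f g. \<lbrakk>f \<in> qcarrier I; g \<in> qcarrier I; P f; P g\<rbrakk> \<Longrightarrow> P (\<lambda>a. f a + g a)"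
    and scale: "\<And>c f. \<lbrakk>f \<in> qcarrier I; P f\<rbrakk> \<Longrightarrow> P (\<lambda>a. c * f a)"
  shows "P f"
proof -
  have "finite {a. f a \<noteq> 0}" using f by (simp add: qcarrier_iff)
  then show ?thesis using f
  proof (induction "{a. f a \<noteq> 0}" arbitrary: f rule: finite_induct)
    case empty
    \<comment> \<open>The rule has no case for zero, so zero is reached as the zero multiple of a
      monomial.\<close>
    then have "f = (\<lambda>a. 0 * qmono (\<lambda>_. 0) a)" by (auto simp: fun_eq_iff)
    then show ?case using scale[of "qmono (\<lambda>_. 0)" 0] mono[of "\<lambda>_. 0"] by simp
  next
    case (insert x F)
    define g where "g = (\<lambda>a. if a = x then 0 else f a)"
    have F: "F = {a. g a \<noteq> 0}" using insert.hyps by (auto simp: g_def)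
    have fx: "f x \<noteq> 0" using insert.hyps by blast
    then have x: "supported_in I x" using insert.prems by (simp add: qcarrier_iff)
    have g: "g \<in> qcarrier I"
      using insert.prems insert.hyps F by (auto simp: qcarrier_iff g_def)
    have 1: "P (\<lambda>a. f x * qmono x a)" "(\<lambda>a. f x * qmono x a) \<in> qcarrier I"
      using scale mono x qcarrier_scale[of "qmono x" I] by auto
    have "P (\<lambda>a. f x * qmono x a + g a)"
      using add[OF 1(2) g 1(1)] insert.hyps(3)[OF F g] by simp
    also have "(\<lambda>a. f x * qmono x a + g a) = f" by (auto simp: g_def qmono_def)
    finally show ?case .
  qed
qed

section \<open>The product and its twist factors\<close>

lemma finite_exponents_below:
  assumes "finite I"
  shows "finite {a. (\<forall>i. a i \<le> c i) \<and> supported_in I a}" (is "finite ?A")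
proof -
  \<comment> \<open>The bounds \<open>c i\<close> are merged into one finite range, so that the
    exponents become functions from \<open>I\<close> into a single finite set, zero
    elsewhere.\<close>
  have "?A \<subseteq> {a. \<forall>i. (i \<in> I \<longrightarrow> a i \<in> (\<Union>i\<in>I. {..c i})) \<and> (i \<notin> I \<longrightarrow> a i = 0)}"
    by (auto simp: supported_in_def)
  moreover have "finite (\<Union>i\<in>I. {..c i})" using assms by simp
  ultimately show ?thesis
    by (rule finite_subset[OF _ finite_set_of_finite_funs[OF assms]])
qed

lemma qmult_eq:
  "qmult I q f g c = (if supported_in I c then
     (\<Sum>a\<in>{a. (\<forall>i. a i \<le> c i) \<and> supported_in I a}.
         f a * g (\<lambda>i. c i - a i) * qtwist I q a (\<lambda>i. c i - a i)) else 0)"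
  unfolding qmult_def supported_in_def by (rule refl)

text \<open>A product over the full square, with 1 wherever \<open>j < i\<close> fails, lets factors
  be combined termwise and the order of multiplication be exchanged. Bilinearity of the twist is
  read off from it.\<close>

lemma qtwist_alt:
  assumes "finite I"
  shows "qtwist I q a b = (\<Prod>i\<in>I. \<Prod>j\<in>I. if j < i then q j i ^ (a i * b j) else 1)"
proof -
  have "qtwist I q a b = (\<Prod>(i,j)\<in>I \<times> I. if j < i then q j i ^ (a i * b j) else 1)"
    unfolding qtwist_def using assms
    by (intro prod.mono_neutral_cong_left) (auto split: if_splits)
  then show ?thesis by (simp add: prod.cartesian_product)
qed

lemma qtwist_add_left:
  assumes "finite I"
  shows "qtwist I q (\<lambda>i. a i + a' i) b = qtwist I q a b * qtwist I q a' b"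
  unfolding qtwist_alt[OF assms] prod.distrib[symmetric]
  by (intro prod.cong refl) (simp add: power_add add_mult_distrib add_mult_distrib2)

lemma qtwist_add_right:
  assumes "finite I"
  shows "qtwist I q a (\<lambda>i. b i + b' i) = qtwist I q a b * qtwist I q a b'"
  unfolding qtwist_alt[OF assms] prod.distrib[symmetric]
  by (intro prod.cong refl) (simp add: power_add add_mult_distrib add_mult_distrib2)

lemma qtwist_zero_left [simp]: "qtwist I q (\<lambda>_. 0) b = 1"
  by (simp add: qtwist_def case_prod_beta)

lemma qtwist_zero_right [simp]: "qtwist I q a (\<lambda>_. 0) = 1"
  by (simp add: qtwist_def case_prod_beta)

lemma qtwist_subset:
  assumes "finite I" "D \<subseteq> I" "supported_in D a" "supported_in D b"
  shows "qtwist I q a b = qtwist D q a b"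
proof -
  have "q j i ^ (a i * b j) = 1" if "i \<notin> D \<or> j \<notin> D" for i j
    using that assms(3,4) by (auto simp: supported_in_def)
  then show ?thesis
    unfolding qtwist_def using assms(1,2)
    by (intro prod.mono_neutral_right) (auto intro: finite_subset[of _ "I \<times> I"])
qed

lemma qtwist_unit_exp:
  assumes "finite I" "i \<in> I" "j \<in> I"
  shows "qtwist I q (unit_exp i) (unit_exp j) = (if j < i then q j i else 1)"
proof -
  have "qtwist I q (unit_exp i) (unit_exp j) =
      (\<Prod>i'\<in>I. \<Prod>j'\<in>I. if i' = i then if j' = j then if j < i then q j i else 1 else 1 else 1)"
    unfolding qtwist_alt[OF assms(1)]
    by (intro prod.cong refl) (simp add: unit_exp_def prod.neutral cong: if_cong)
  also have "\<dots> = (\<Prod>i'\<in>I. if i' = i then if j < i then q j i else 1 else 1)"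
    using assms by (intro prod.cong refl) simp
  finally show ?thesis using assms by simp
qed

text \<open>The support of a product lies in the sumset of the two supports, which is
  finite.\<close>

lemma qmult_qcarrier:
  assumes "finite I" "f \<in> qcarrier I" "g \<in> qcarrier I"
  shows "qmult I q f g \<in> qcarrier I"
proof -
  have "{c. qmult I q f g c \<noteq> 0} \<subseteq> (\<lambda>(a,b). (\<lambda>i. a i + b i)) ` ({a. f a \<noteq> 0} \<times> {b. g b \<noteq> 0})"
  proof
    fix c assume "c \<in> {c. qmult I q f g c \<noteq> 0}"
    then have "(\<Sum>a\<in>{a. (\<forall>i. a i \<le> c i) \<and> supported_in I a}.
        f a * g (\<lambda>i. c i - a i) * qtwist I q a (\<lambda>i. c i - a i)) \<noteq> 0"
      by (simp add: qmult_eq split: if_splits)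
    then obtain a where a: "\<forall>i. a i \<le> c i" "f a \<noteq> 0" "g (\<lambda>i. c i - a i) \<noteq> 0"
      by (rule sum.not_neutral_contains_not_neutral) auto
    have "c = (\<lambda>i. a i + (c i - a i))" using a by (auto simp: fun_eq_iff)
    then show "c \<in> (\<lambda>(a,b). (\<lambda>i. a i + b i)) ` ({a. f a \<noteq> 0} \<times> {b. g b \<noteq> 0})"
      using a by (intro image_eqI[of _ _ "(a, \<lambda>i. c i - a i)"]) auto
  qed
  moreover have "finite ({a. f a \<noteq> 0} \<times> {b. g b \<noteq> 0})"
    using assms by (simp add: qcarrier_iff)
  ultimately have "finite {c. qmult I q f g c \<noteq> 0}"
    using finite_surj by blast
  then show ?thesis by (auto simp: qcarrier_iff qmult_eq)
qed

text \<open>Elements are coefficient functions on all exponents, so the algebra of \<open>D\<close>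
  sits inside that of \<open>I\<close> without an embedding map. The products agree because twist
  factors with an index outside \<open>D\<close> have exponent zero, and sums of exponents supported
  in \<open>D\<close> are again supported in \<open>D\<close>.\<close>

lemma qmult_subset:
  assumes "finite I" "D \<subseteq> I" "f \<in> qcarrier D" "g \<in> qcarrier D"
  shows "qmult I q f g = qmult D q f g"
proof
  fix c
  show "qmult I q f g c = qmult D q f g c"
  proof (cases "supported_in D c")
    case True
    then have c: "supported_in I c" using assms supported_in_mono by blast
    have "{a. (\<forall>i. a i \<le> c i) \<and> supported_in I a} = {a. (\<forall>i. a i \<le> c i) \<and> supported_in D a}"
      using supported_in_le[OF c] supported_in_le[OF True] by blast
    then show ?thesis
      using True c assms(1,2) supported_in_diff[OF True]
      by (auto simp: qmult_eq qtwist_subset[OF assms(1,2)] intro!: sum.cong)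
  next
    case False
    have "f a * g (\<lambda>i. c i - a i) * qtwist I q a (\<lambda>i. c i - a i) = 0" if "\<forall>i. a i \<le> c i" for a
    proof (rule ccontr)
      assume "\<not> ?thesis"
      then have "supported_in D a" "supported_in D (\<lambda>i. c i - a i)"
        using assms by (auto simp: qcarrier_iff)
      then have "supported_in D (\<lambda>i. a i + (c i - a i))" by simp
      moreover have "(\<lambda>i. a i + (c i - a i)) = c" using that by (auto simp: fun_eq_iff)
      ultimately show False using False by simp
    qed
    then show ?thesis using False by (auto simp: qmult_eq intro!: sum.neutral)
  qed
qed

lemma qmult_qmono:
  assumes "finite I" "supported_in I a" "supported_in I b"
  shows "qmult I q (qmono a) (qmono b) = (\<lambda>c. qtwist I q a b * qmono (\<lambda>i. a i + b i) c)"
proof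
  fix c
  show "qmult I q (qmono a) (qmono b) c = qtwist I q a b * qmono (\<lambda>i. a i + b i) c"
  proof (cases "supported_in I c")
    case True
    let ?S = "{a. (\<forall>i. a i \<le> c i) \<and> supported_in I a}"
    have fin: "finite ?S" using finite_exponents_below assms by blast
    \<comment> \<open>Subtraction is truncated, so \<open>c - a = b\<close> alone does not give
      \<open>c = a + b\<close>; membership of \<open>a\<close> in \<open>?S\<close> supplies the
      missing bound.\<close>
    have eq: "c = (\<lambda>i. a i + b i) \<longleftrightarrow> (\<lambda>i. c i - a i) = b \<and> a \<in> ?S"
      using assms by (auto simp: fun_eq_iff) (metis le_add_diff_inverse)
    have "qmult I q (qmono a) (qmono b) c =
        (\<Sum>x\<in>?S. if a = x then qmono b (\<lambda>i. c i - a i) * qtwist I q a (\<lambda>i. c i - a i) else 0)"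
      using True by (auto simp: qmult_eq qmono_def intro!: sum.cong)
    also have "\<dots> = (if a \<in> ?S then qmono b (\<lambda>i. c i - a i) * qtwist I q a (\<lambda>i. c i - a i) else 0)"
      using fin by simp
    also have "\<dots> = qtwist I q a b * qmono (\<lambda>i. a i + b i) c"
      unfolding qmono_def eq by auto
    finally show ?thesis .
  next
    case False
    then show ?thesis using assms by (auto simp: qmult_eq qmono_def)
  qed
qed

lemma qdeg_add: "qdeg I (\<lambda>i. a i + b i) = qdeg I a + qdeg I b"
  by (simp add: qdeg_def sum.distrib)

lemma qdeg_subset: "finite I \<Longrightarrow> D \<subseteq> I \<Longrightarrow> supported_in D a \<Longrightarrow> qdeg I a = qdeg D a"
  unfolding qdeg_def by (rule sum.mono_neutral_right) (auto simp: supported_in_def)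

lemma qdeg_unit_exp: "finite I \<Longrightarrow> i \<in> I \<Longrightarrow> qdeg I (unit_exp i) = 1"
  by (simp add: qdeg_def unit_exp_def)

section \<open>Generation of the algebra by the v_i\<close>

locale quantum_matrix =
  fixes I :: "nat set" and q :: "nat \<Rightarrow> nat \<Rightarrow> 'k::field"
  assumes finite_index: "finite I"
    and diag: "i \<in> I \<Longrightarrow> q i i = 1"
    and skew: "\<lbrakk>i \<in> I; j \<in> I\<rbrakk> \<Longrightarrow> q i j * q j i = 1"
begin

lemma quantum_matrix_subset:
  assumes "D \<subseteq> I"
  shows "quantum_matrix D q"
proof
  show "finite D" using assms finite_index by (rule finite_subset)
  show "q i i = 1" if "i \<in> D" for i
    using that assms diag[of i] by (simp add: subsetD)
  show "q i j * q j i = 1" if "i \<in> D" "j \<in> D" for i j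
    using that assms skew[of i j] by (simp add: subsetD)
qed

lemma qtwist_nonzero [simp]: "qtwist I q a b \<noteq> 0"
proof -
  have "q j i \<noteq> 0" if "i \<in> I" "j \<in> I" for i j using skew[OF that] by auto
  then show ?thesis using finite_index by (auto simp: qtwist_alt)
qed

lemma qgen_qmono_eq:
  assumes "supported_in I a" "a i > 0"
  shows "qmono a = (\<lambda>c. inverse (qtwist I q (unit_exp i) (\<lambda>j. a j - unit_exp i j)) *
           qmult I q (qgen i) (qmono (\<lambda>j. a j - unit_exp i j)) c)"
proof -
  have i: "i \<in> I" using assms by (auto simp: supported_in_def)
  have "(\<lambda>j. unit_exp i j + (a j - unit_exp i j)) = a"
    using assms by (auto simp: fun_eq_iff unit_exp_def)
  then show ?thesis
    using i finite_index supported_in_diff[OF assms(1)] by (simp add: qmult_qmono fun_eq_iff)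
qed

text \<open>This expresses that the v_i generate the algebra. Splitting one generator off a monomial
  lowers its degree and costs a twist factor, which is invertible and absorbed by the scaling
  case.\<close>

lemma qcarrier_generator_induct [consumes 1, case_names one generator add scale]:
  assumes f: "f \<in> qcarrier I"
    and one: "P qone"
    and gen: "\<And>i f. \<lbrakk>i \<in> I; f \<in> qcarrier I; P f\<rbrakk> \<Longrightarrow> P (qmult I q (qgen i) f)"
    and add: "\<And>f g. \<lbrakk>f \<in> qcarrier I; g \<in> qcarrier I; P f; P g\<rbrakk> \<Longrightarrow> P (\<lambda>a. f a + g a)"
    and scale: "\<And>c f. \<lbrakk>f \<in> qcarrier I; P f\<rbrakk> \<Longrightarrow> P (\<lambda>a. c * f a)"
  shows "P f"
  using f
proof (induction rule: qcarrier_induct)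
  case (mono a)
  then show ?case
  proof (induction "qdeg I a" arbitrary: a)
    case 0
    then have "a = (\<lambda>_. 0)"
      using finite_index by (auto simp: qdeg_def supported_in_def fun_eq_iff)
    then show ?case using one by (simp add: qone_eq_qmono)
  next
    case (Suc d)
    then obtain i where i: "i \<in> I" "a i > 0"
      unfolding qdeg_def by (metis gr0I nat.distinct(1) sum.neutral)
    define b where "b = (\<lambda>j. a j - unit_exp i j)"
    have a: "a = (\<lambda>j. unit_exp i j + b j)" using i by (auto simp: b_def unit_exp_def fun_eq_iff)
    have b: "supported_in I b" using Suc unfolding b_def by (intro supported_in_diff)
    have "qdeg I a = Suc (qdeg I b)"
      by (subst a) (use i finite_index in \<open>simp add: qdeg_add qdeg_unit_exp\<close>)
    then have "P (qmult I q (qgen i) (qmono b))" using Suc b i by (intro gen) auto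
    moreover have "qmult I q (qgen i) (qmono b) \<in> qcarrier I"
      using i b finite_index by (intro qmult_qcarrier) auto
    ultimately show ?case
      using scale[of "qmult I q (qgen i) (qmono b)"] qgen_qmono_eq[OF Suc.prems i(2)]
      by (simp add: b_def)
  qed
qed (rule add scale; assumption)+

end

section \<open>Homogeneous components and graded automorphisms\<close>

definition hcomp :: "nat set \<Rightarrow> nat \<Rightarrow> ((nat \<Rightarrow> nat) \<Rightarrow> 'k::field) \<Rightarrow> (nat \<Rightarrow> nat) \<Rightarrow> 'k" where
  "hcomp I d f = (\<lambda>a. if qdeg I a = d then f a else 0)"

lemma hcomp_in_qcarrier: "f \<in> qcarrier I \<Longrightarrow> hcomp I d f \<in> qcarrier I"
  using qcarrier_scale[of f I "\<lambda>a. if qdeg I a = d then 1 else 0"]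
  by (simp add: hcomp_def if_distrib[of "\<lambda>x. x * _"] cong: if_cong)

lemma qhomog_iff_hcomp: "qhomog I d f \<longleftrightarrow> hcomp I d f = f"
  by (auto simp: qhomog_def hcomp_def fun_eq_iff)

lemma qhomog_subset:
  assumes "finite I" "D \<subseteq> I" "f \<in> qcarrier D"
  shows "qhomog I d f \<longleftrightarrow> qhomog D d f"
proof -
  have "qdeg I a = qdeg D a" if "f a \<noteq> 0" for a
    using that assms qdeg_subset[OF assms(1,2)] by (simp add: qcarrier_iff)
  then show ?thesis by (auto simp: qhomog_def)
qed

lemma qhomog_qmono: "qhomog I (qdeg I a) (qmono a)"
  by (simp add: qhomog_def qmono_def)

context
  fixes I :: "nat set" and q :: "nat \<Rightarrow> nat \<Rightarrow> 'k::field" and \<phi>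
  assumes aut: "\<phi> \<in> qgraut I q"
begin

lemma graut_extensional: "\<phi> \<in> extensional (qcarrier I)"
  and graut_bij: "bij_betw \<phi> (qcarrier I) (qcarrier I)"
  and graut_one: "\<phi> qone = qone"
  using aut unfolding qgraut_def mem_Collect_eq by blast+

lemma graut_add:
    "\<lbrakk>f \<in> qcarrier I; g \<in> qcarrier I\<rbrakk> \<Longrightarrow> \<phi> (\<lambda>a. f a + g a) = (\<lambda>a. \<phi> f a + \<phi> g a)"
  and graut_scale: "f \<in> qcarrier I \<Longrightarrow> \<phi> (\<lambda>a. c * f a) = (\<lambda>a. c * \<phi> f a)"
  and graut_mult:
    "\<lbrakk>f \<in> qcarrier I; g \<in> qcarrier I\<rbrakk> \<Longrightarrow> \<phi> (qmult I q f g) = qmult I q (\<phi> f) (\<phi> g)"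
  and graut_homog: "\<lbrakk>f \<in> qcarrier I; qhomog I d f\<rbrakk> \<Longrightarrow> qhomog I d (\<phi> f)"
  using aut unfolding qgraut_def mem_Collect_eq by blast+

lemma graut_in_qcarrier: "f \<in> qcarrier I \<Longrightarrow> \<phi> f \<in> qcarrier I"
  using graut_bij by (rule bij_betwE[rule_format])

lemma graut_inj: "\<lbrakk>f \<in> qcarrier I; g \<in> qcarrier I; \<phi> f = \<phi> g\<rbrakk> \<Longrightarrow> f = g"
  using graut_bij unfolding bij_betw_def inj_on_def by blast

lemma graut_zero: "\<phi> (\<lambda>_. 0) = (\<lambda>_. 0)"
  using graut_scale[of qone 0] by simp

lemma graut_sum:
  assumes "finite S" "\<And>b. b \<in> S \<Longrightarrow> F b \<in> qcarrier I"
  shows "\<phi> (\<lambda>c. \<Sum>b\<in>S. F b c) = (\<lambda>c. \<Sum>b\<in>S. \<phi> (F b) c)"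
  using assms
proof (induction S rule: finite_induct)
  case empty
  then show ?case by (simp add: graut_zero)
next
  case (insert b S)
  then show ?case using graut_add[of "F b" "\<lambda>c. \<Sum>b\<in>S. F b c"] by (simp add: qcarrier_sum)
qed

text \<open>Membership in \<open>qgraut\<close> only asks that homogeneous elements keep their
  degree. On a monomial this already decides both sides, and linearity does the rest.\<close>

lemma graut_hcomp:
  assumes "f \<in> qcarrier I"
  shows "\<phi> (hcomp I d f) = hcomp I d (\<phi> f)"
  using assms
proof (induction rule: qcarrier_induct)
  case (mono a)
  have h: "qhomog I (qdeg I a) (\<phi> (qmono a))"
    using mono by (intro graut_homog qhomog_qmono) simp
  show ?case
  proof (cases "qdeg I a = d")
    case True
    then have "hcomp I d (qmono a) = (qmono a :: (nat \<Rightarrow> nat) \<Rightarrow> 'k)"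
      using qhomog_qmono[of I a] by (simp add: qhomog_iff_hcomp)
    then show ?thesis using h True by (simp add: qhomog_iff_hcomp)
  next
    case False
    then have "hcomp I d (qmono a) = (\<lambda>_. 0 :: 'k)"
      by (auto simp: hcomp_def qmono_def)
    moreover have "hcomp I d (\<phi> (qmono a)) = (\<lambda>_. 0)"
      using h False by (auto simp: hcomp_def qhomog_def fun_eq_iff)
    ultimately show ?thesis by (simp add: graut_zero)
  qed
next
  case (add f g)
  have *: "hcomp I d (\<lambda>a. u a + v a) = (\<lambda>a. hcomp I d u a + hcomp I d v a)"
    for u v :: "(nat \<Rightarrow> nat) \<Rightarrow> 'k"
    by (auto simp: hcomp_def)
  show ?case using add by (simp add: * graut_add hcomp_in_qcarrier)
next
  case (scale c f)
  have *: "hcomp I d (\<lambda>a. c * u a) = (\<lambda>a. c * hcomp I d u a)" for u :: "(nat \<Rightarrow> nat) \<Rightarrow> 'k"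
    by (auto simp: hcomp_def)
  show ?case using scale by (simp add: * graut_scale hcomp_in_qcarrier)
qed

text \<open>On each homogeneous component the factor is a single scalar, so linearity and
  \<open>graut_hcomp\<close> suffice. Here the grading enters the multiplicativity of
  \<open>extend\<close>: moving an outside monomial past a block element rescales that element in
  just this way.\<close>

lemma graut_power_deg:
  assumes "f \<in> qcarrier I"
  shows "\<phi> (\<lambda>a. s ^ qdeg I a * f a) = (\<lambda>a. s ^ qdeg I a * \<phi> f a)"
proof
  fix a
  let ?f = "\<lambda>a. s ^ qdeg I a * f a" and ?d = "qdeg I a"
  have "\<phi> ?f a = hcomp I ?d (\<phi> ?f) a" by (simp add: hcomp_def)
  also have "\<dots> = \<phi> (hcomp I ?d ?f) a" using assms by (simp add: graut_hcomp qcarrier_scale)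
  also have "hcomp I ?d ?f = (\<lambda>b. s ^ ?d * hcomp I ?d f b)" by (auto simp: hcomp_def)
  also have "\<phi> \<dots> a = s ^ ?d * hcomp I ?d (\<phi> f) a"
    using assms by (simp add: graut_scale graut_hcomp hcomp_in_qcarrier)
  finally show "\<phi> ?f a = s ^ ?d * \<phi> f a" by (simp add: hcomp_def)
qed

text \<open>The algebraic laws for the inverse are pulled back through the injectivity of
  \<open>\<phi>\<close>. Homogeneity follows in the same way, because \<open>\<phi>\<close> commutes
  with the projections \<open>hcomp\<close>.\<close>

lemma graut_inverse:
  assumes "finite I"
  shows "restrict (inv_into (qcarrier I) \<phi>) (qcarrier I) \<in> qgraut I q"
proof -
  let ?C = "qcarrier I :: ((nat \<Rightarrow> nat) \<Rightarrow> 'k) set"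
  define \<psi> where "\<psi> = restrict (inv_into ?C \<phi>) ?C"
  have bij: "bij_betw \<psi> ?C ?C"
    unfolding \<psi>_def using graut_bij by (simp add: bij_betw_inv_into)
  have in_C: "\<psi> f \<in> ?C" if "f \<in> ?C" for f using bij that by (rule bij_betwE[rule_format])
  have right: "\<phi> (\<psi> f) = f" if "f \<in> ?C" for f
    using that graut_bij by (simp add: \<psi>_def bij_betw_inv_into_right)
  have left: "\<psi> f = g" if "f \<in> ?C" "g \<in> ?C" "\<phi> g = f" for f g
    using that in_C right graut_inj by metis
  have "\<psi> (\<lambda>a. f a + g a) = (\<lambda>a. \<psi> f a + \<psi> g a)" if "f \<in> ?C" "g \<in> ?C" for f g
    using that by (intro left) (simp_all add: qcarrier_add in_C graut_add right)
  moreover have "\<psi> (\<lambda>a. c * f a) = (\<lambda>a. c * \<psi> f a)" if "f \<in> ?C" for c f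
    using that by (intro left) (simp_all add: qcarrier_scale in_C graut_scale right)
  moreover have "\<psi> (qmult I q f g) = qmult I q (\<psi> f) (\<psi> g)" if "f \<in> ?C" "g \<in> ?C" for f g
    using that assms by (intro left) (simp_all add: qmult_qcarrier in_C graut_mult right)
  moreover have "\<psi> qone = qone" by (intro left) (simp_all add: graut_one)
  moreover have "qhomog I d (\<psi> f)" if "f \<in> ?C" "qhomog I d f" for d f
  proof -
    have "\<phi> (hcomp I d (\<psi> f)) = \<phi> (\<psi> f)"
      using that in_C right by (simp add: graut_hcomp qhomog_iff_hcomp)
    then show ?thesis
      unfolding qhomog_iff_hcomp by (rule graut_inj[rotated -1]) (simp_all add: that in_C hcomp_in_qcarrier)
  qed
  ultimately show ?thesis
    unfolding \<psi>_def[symmetric] qgraut_def using bij by (simp add: \<psi>_def)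
qed

end

section \<open>Determination by generators and restriction to invariant blocks\<close>

context quantum_matrix
begin

lemma graut_eqI:
  assumes "\<phi> \<in> qgraut I q" "\<psi> \<in> qgraut I q" "\<And>i. i \<in> I \<Longrightarrow> \<phi> (qgen i) = \<psi> (qgen i)"
  shows "\<phi> = \<psi>"
proof (rule extensionalityI[of _ "qcarrier I"])
  fix f :: "(nat \<Rightarrow> nat) \<Rightarrow> 'k"
  assume "f \<in> qcarrier I"
  then show "\<phi> f = \<psi> f"
    by (induction rule: qcarrier_generator_induct)
      (simp_all add: assms(3) graut_one[OF assms(1)] graut_one[OF assms(2)]
        graut_mult[OF assms(1)] graut_mult[OF assms(2)] graut_add[OF assms(1)] graut_add[OF assms(2)]
        graut_scale[OF assms(1)] graut_scale[OF assms(2)])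
qed (use assms in \<open>simp_all add: graut_extensional\<close>)

lemma graut_preserves_subalgebra:
  assumes "D \<subseteq> I" "\<phi> \<in> qgraut I q" "\<forall>i\<in>D. \<phi> (qgen i) \<in> qcarrier D" "f \<in> qcarrier D"
  shows "\<phi> f \<in> qcarrier D"
proof -
  interpret D: quantum_matrix D q using assms(1) by (rule quantum_matrix_subset)
  note sub = subsetD[OF qcarrier_mono[OF assms(1)]]
  show ?thesis
    using assms(4)
  proof (induction rule: D.qcarrier_generator_induct)
    case one
    then show ?case by (simp add: graut_one[OF assms(2)])
  next
    case (generator i f)
    have i: "(qgen i :: (nat \<Rightarrow> nat) \<Rightarrow> 'k) \<in> qcarrier D" using generator by simp
    have "\<phi> (qmult D q (qgen i) f) = qmult D q (\<phi> (qgen i)) (\<phi> f)"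
      using graut_mult[OF assms(2) sub[OF i] sub[OF generator(2)]]
      unfolding qmult_subset[OF finite_index assms(1) i generator(2)]
        qmult_subset[OF finite_index assms(1) bspec[OF assms(3) generator(1)] generator(3)] .
    then show ?case
      using generator assms(3) D.finite_index by (simp add: qmult_qcarrier)
  next
    case (add f g)
    then show ?case by (simp add: graut_add[OF assms(2)] sub qcarrier_add)
  next
    case (scale c f)
    then show ?case by (simp add: graut_scale[OF assms(2)] sub qcarrier_scale)
  qed
qed

text \<open>The hypothesis on generators ranges over all automorphisms: applied to the inverse of
  \<open>\<phi>\<close>, it shows that \<open>\<phi>\<close> maps the block algebra onto
  itself.\<close>

lemma graut_restrict:
  assumes "D \<subseteq> I" "\<phi> \<in> qgraut I q"
    and inv: "\<forall>\<psi>\<in>qgraut I q. \<forall>i\<in>D. \<psi> (qgen i) \<in> qcarrier D"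
  shows "restrict \<phi> (qcarrier D) \<in> qgraut D q"
proof -
  let ?C = "qcarrier I :: ((nat \<Rightarrow> nat) \<Rightarrow> 'k) set" and ?CD = "qcarrier D :: ((nat \<Rightarrow> nat) \<Rightarrow> 'k) set"
  interpret D: quantum_matrix D q using assms(1) by (rule quantum_matrix_subset)
  note sub = subsetD[OF qcarrier_mono[OF assms(1)]]
  have into: "\<psi> f \<in> ?CD" if "\<psi> \<in> qgraut I q" "f \<in> ?CD" for \<psi> f
    using assms(1) that(1) bspec[OF inv that(1)] that(2) by (rule graut_preserves_subalgebra)
  have "bij_betw \<phi> ?CD ?CD"
    unfolding bij_betw_def
  proof
    show "inj_on \<phi> ?CD" using graut_inj[OF assms(2)] sub by (auto intro: inj_onI)
    show "\<phi> ` ?CD = ?CD"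
    proof
      show "\<phi> ` ?CD \<subseteq> ?CD" using into[OF assms(2)] by auto
      show "?CD \<subseteq> \<phi> ` ?CD"
      proof
        fix f assume f: "f \<in> ?CD"
        let ?g = "restrict (inv_into ?C \<phi>) ?C f"
        have g: "?g \<in> ?CD" using into[OF graut_inverse[OF assms(2) finite_index] f] .
        have "\<phi> ?g = f"
          using sub[OF f] graut_bij[OF assms(2)] by (simp add: bij_betw_inv_into_right)
        then show "f \<in> \<phi> ` ?CD" using g by (metis imageI)
      qed
    qed
  qed
  moreover have "\<phi> (qmult D q f g) = qmult D q (\<phi> f) (\<phi> g)" if "f \<in> ?CD" "g \<in> ?CD" for f g
    using graut_mult[OF assms(2) sub[OF that(1)] sub[OF that(2)]]
    unfolding qmult_subset[OF finite_index assms(1) that]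
      qmult_subset[OF finite_index assms(1) into[OF assms(2) that(1)] into[OF assms(2) that(2)]] .
  moreover have "qhomog D d (\<phi> f)" if "f \<in> ?CD" "qhomog D d f" for d f
    using graut_homog[OF assms(2) sub[OF that(1)]] that(2)
    unfolding qhomog_subset[OF finite_index assms(1) that(1)]
      qhomog_subset[OF finite_index assms(1) into[OF assms(2) that(1)]] .
  moreover have "\<phi> (\<lambda>a. f a + g a) = (\<lambda>a. \<phi> f a + \<phi> g a)" if "f \<in> ?CD" "g \<in> ?CD" for f g
    using graut_add[OF assms(2) sub[OF that(1)] sub[OF that(2)]] .
  moreover have "\<phi> (\<lambda>a. c * f a) = (\<lambda>a. c * \<phi> f a)" if "f \<in> ?CD" for c f
    using graut_scale[OF assms(2) sub[OF that]] .
  ultimately show ?thesis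
    using D.finite_index
    by (simp add: qgraut_def graut_one[OF assms(2)] qcarrier_add qcarrier_scale qmult_qcarrier)
qed

section \<open>Commutation relations in degree one\<close>

lemma qgen_relation:
  assumes "i \<in> I" "j \<in> I"
  shows "qmult I q (qgen j) (qgen i) = (\<lambda>c. q i j * qmult I q (qgen i) (qgen j) c)"
proof -
  \<comment> \<open>Both products are multiples of the same monomial, so the defining relation
    becomes an identity of twists. The case \<open>j < i\<close> uses skewness, and
    \<open>i = j\<close> the unit diagonal.\<close>
  have "qtwist I q (unit_exp j) (unit_exp i) = q i j * qtwist I q (unit_exp i) (unit_exp j)"
    using assms skew[of i j] diag[of i] finite_index by (cases i j rule: linorder_cases) (simp_all add: qtwist_unit_exp)
  moreover have "(\<lambda>c. unit_exp j c + unit_exp i c) = (\<lambda>c. unit_exp i c + unit_exp j c)"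
    by (simp add: add.commute)
  ultimately show ?thesis using assms finite_index by (simp add: qmult_qmono mult.assoc)
qed

lemma exponent_deg_one:
  assumes "supported_in I a" "qdeg I a = 1"
  obtains i where "i \<in> I" "a = unit_exp i"
proof -
  obtain i where i: "i \<in> I" "a i \<noteq> 0"
    using assms(2) unfolding qdeg_def by (metis sum.neutral zero_neq_one)
  have "qdeg I a = a i + sum a (I - {i})"
    using i finite_index by (simp add: qdeg_def sum.remove)
  then have "a i = 1" "sum a (I - {i}) = 0" using assms(2) i by auto
  then have "a j = unit_exp i j" for j
    using finite_index assms(1) by (cases "j \<in> I") (auto simp: unit_exp_def supported_in_def)
  then show ?thesis using i that by blast
qed

lemma deg_one_support:
  assumes "f \<in> qcarrier I" "qhomog I 1 f" "f a \<noteq> 0"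
  obtains i where "i \<in> I" "a = unit_exp i"
  using assms exponent_deg_one[of a] unfolding qhomog_def qcarrier_iff by blast

text \<open>As \<open>f\<close> is concentrated in degree one, a splitting of the exponent
  contributes only if its left part is \<open>unit_exp a\<close> or \<open>unit_exp b\<close>. For
  \<open>a = b\<close> these coincide and the twist is 1.\<close>

lemma qmult_deg_one:
  assumes f: "f \<in> qcarrier I" "qhomog I 1 f" and ab: "a \<in> I" "b \<in> I"
  shows "qmult I q f g (\<lambda>i. unit_exp a i + unit_exp b i) =
    (if a = b then f (unit_exp a) * g (unit_exp a) else
      f (unit_exp a) * g (unit_exp b) * qtwist I q (unit_exp a) (unit_exp b) +
      f (unit_exp b) * g (unit_exp a) * qtwist I q (unit_exp b) (unit_exp a))"
proof -
  let ?c = "\<lambda>i. unit_exp a i + unit_exp b i"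
  let ?S = "{x. (\<forall>i. x i \<le> ?c i) \<and> supported_in I x}"
  let ?F = "\<lambda>x. f x * g (\<lambda>i. ?c i - x i) * qtwist I q x (\<lambda>i. ?c i - x i)"
  have zero: "?F x = 0" if "x \<in> ?S - {unit_exp a, unit_exp b}" for x
  proof (rule ccontr)
    assume "\<not> ?thesis"
    then have "f x \<noteq> 0" by auto
    then obtain k where k: "x = unit_exp k" using deg_one_support[OF f] by blast
    then have "unit_exp k k \<le> ?c k" using that by blast
    then show False using that k by (auto simp: unit_exp_def split: if_splits)
  qed
  have "qmult I q f g ?c = (\<Sum>x\<in>?S. ?F x)" using ab by (simp add: qmult_eq)
  also have "\<dots> = (\<Sum>x\<in>{unit_exp a, unit_exp b}. ?F x)"
    using ab zero finite_exponents_below[OF finite_index]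
    by (intro sum.mono_neutral_right) (auto simp: unit_exp_def supported_in_def)
  finally show ?thesis
    using ab finite_index by (auto simp: qtwist_unit_exp)
qed

text \<open>Apply \<open>\<phi>\<close> to the relation between v_i and v_j and compare
  coefficients, at v_a v_b for the first equation and at the square of v_a for the second.\<close>

lemma graut_coefficient_relation:
  assumes aut: "\<phi> \<in> qgraut I q" and ij: "i \<in> I" "j \<in> I" and ab: "a \<in> I" "b \<in> I"
  defines "v \<equiv> \<phi> (qgen i)" and "w \<equiv> \<phi> (qgen j)"
  shows "a \<noteq> b \<Longrightarrow> (q a b - q i j) * v (unit_exp a) * w (unit_exp b) =
           (q i j * q a b - 1) * v (unit_exp b) * w (unit_exp a)"
    and "(1 - q i j) * v (unit_exp a) * w (unit_exp a) = 0"
proof -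
  have gen: "\<phi> (qgen k) \<in> qcarrier I \<and> qhomog I 1 (\<phi> (qgen k))" if "k \<in> I" for k
    using that graut_in_qcarrier[OF aut, of "qgen k"] graut_homog[OF aut, of "qgen k" 1]
      qhomog_qmono[of I "unit_exp k", where 'a='k] qdeg_unit_exp[OF finite_index that] by simp
  have "qmult I q w v = \<phi> (qmult I q (qgen j) (qgen i))"
    using ij graut_mult[OF aut, of "qgen j" "qgen i"] by (simp add: v_def w_def)
  also have "\<dots> = (\<lambda>c. q i j * \<phi> (qmult I q (qgen i) (qgen j)) c)"
    unfolding qgen_relation[OF ij]
    using ij finite_index by (intro graut_scale[OF aut] qmult_qcarrier) auto
  also have "\<phi> (qmult I q (qgen i) (qgen j)) = qmult I q v w"
    using ij graut_mult[OF aut, of "qgen i" "qgen j"] by (simp add: v_def w_def)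
  finally have rel: "qmult I q w v c = q i j * qmult I q v w c" for c by (simp add: fun_eq_iff)
  note v = conjunct1[OF gen[OF ij(1)]] conjunct2[OF gen[OF ij(1)]]
  note w = conjunct1[OF gen[OF ij(2)]] conjunct2[OF gen[OF ij(2)]]
  show "(1 - q i j) * v (unit_exp a) * w (unit_exp a) = 0"
    using rel[of "\<lambda>i. unit_exp a i + unit_exp a i"]
    unfolding v_def w_def qmult_deg_one[OF v ab(1) ab(1)] qmult_deg_one[OF w ab(1) ab(1)]
    by (simp add: algebra_simps)
  assume "a \<noteq> b"
  let ?t = "qtwist I q (unit_exp a) (unit_exp b)"
  \<comment> \<open>Reversing the two generators multiplies the twist by \<open>q a b\<close>
    whichever index is smaller, so one formula covers both orders. The common factor
    \<open>?t\<close> is then cancelled.\<close>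
  have t: "qtwist I q (unit_exp b) (unit_exp a) = q a b * ?t"
    using ab skew[of a b] finite_index \<open>a \<noteq> b\<close>
    by (cases a b rule: linorder_cases) (simp_all add: qtwist_unit_exp)
  have "?t * ((q a b - q i j) * v (unit_exp a) * w (unit_exp b)) =
      ?t * ((q i j * q a b - 1) * v (unit_exp b) * w (unit_exp a))"
    using rel[of "\<lambda>i. unit_exp a i + unit_exp b i"] \<open>a \<noteq> b\<close>
    unfolding v_def w_def qmult_deg_one[OF v ab] qmult_deg_one[OF w ab] t
    by (simp add: algebra_simps)
  then show "(q a b - q i j) * v (unit_exp a) * w (unit_exp b) =
      (q i j * q a b - 1) * v (unit_exp b) * w (unit_exp a)" by simp
qed

end

section \<open>Dimension counts and permuted rows\<close>

lemma underdetermined_linear_system: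
  fixes G :: "'b \<Rightarrow> 'a \<Rightarrow> 'k::field"
  assumes "finite B" "finite J" "card B < card J"
  shows "\<exists>x. (\<exists>j\<in>J. x j \<noteq> 0) \<and> (\<forall>b\<in>B. (\<Sum>j\<in>J. x j * G b j) = 0)"
  using assms
proof (induction B arbitrary: J G rule: finite_induct)
  case empty
  then have "J \<noteq> {}" by auto
  then show ?case by (intro exI[of _ "\<lambda>_. 1"]) auto
next
  case (insert b B)
  show ?case
  proof (cases "\<forall>j\<in>J. G b j = 0")
    case True
    then show ?thesis using insert.IH[of J G] insert.prems insert.hyps by simp
  next
    case False
    then obtain m where m: "m \<in> J" "G b m \<noteq> 0" by blast
    \<comment> \<open>Gaussian elimination: multiples of equation \<open>b\<close>, with pivot
      \<open>m\<close>, are subtracted from the other equations to clear the unknown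
      \<open>x m\<close>.\<close>
    define H where "H = (\<lambda>b' j. G b' j - G b j / G b m * G b' m)"
    have "card B < card (J - {m})" using insert.prems insert.hyps m by simp
    then obtain x where x: "\<exists>j\<in>J - {m}. x j \<noteq> 0" "\<forall>b'\<in>B. (\<Sum>j\<in>J - {m}. x j * H b' j) = 0"
      using insert.IH[of "J - {m}" H] insert.prems by auto
    \<comment> \<open>The value of the pivot unknown that equation \<open>b\<close> forces.\<close>
    define s where "s = - (\<Sum>j\<in>J - {m}. x j * G b j) / G b m"
    have "(\<Sum>j\<in>J. (x(m := s)) j * G b' j) = s * G b' m + (\<Sum>j\<in>J - {m}. x j * G b' j)" for b'
      using insert.prems m by (simp add: sum.remove)
    moreover have "s * G b m + (\<Sum>j\<in>J - {m}. x j * G b j) = 0" using m by (simp add: s_def)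
    moreover have "s * G b' m + (\<Sum>j\<in>J - {m}. x j * G b' j) = (\<Sum>j\<in>J - {m}. x j * H b' j)" for b'
      by (simp add: H_def s_def algebra_simps sum_subtractf sum_distrib_left sum_divide_distrib)
    ultimately have "\<forall>b'\<in>insert b B. (\<Sum>j\<in>J. (x(m := s)) j * G b' j) = 0" using x(2) by simp
    moreover have "\<exists>j\<in>J. (x(m := s)) j \<noteq> 0" using x(1) by auto
    ultimately show ?thesis by blast
  qed
qed

text \<open>Each fibre inequality compares two multiplicities. Both multisets have size
  \<open>card A\<close>, so none of the inequalities can be strict.\<close>

lemma image_mset_eqI_card_le:
  assumes "finite A" "\<And>c. card {x \<in> A. f x = c} \<le> card {x \<in> A. g x = c}"
  shows "image_mset f (mset_set A) = image_mset g (mset_set A)"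
proof (rule ccontr)
  assume ne: "\<not> ?thesis"
  have count: "count (image_mset h (mset_set A)) c = card {x \<in> A. h x = c}" for h :: "'a \<Rightarrow> 'b" and c
    using assms(1) by (simp add: count_image_mset_eq_card_vimage vimage_def Int_def conj_commute)
  have "image_mset f (mset_set A) \<subseteq># image_mset g (mset_set A)"
    using assms(2) by (simp add: subseteq_mset_def count)
  then have "size (image_mset f (mset_set A)) < size (image_mset g (mset_set A))"
    using ne by (intro mset_subset_size) (simp add: subset_mset.le_neq_trans)
  then show False by simp
qed

context quantum_matrix
begin

text \<open>Otherwise some nontrivial combination \<open>w\<close> of the \<open>\<phi> v_j\<close> with \<open>q i j = l\<close> has vanishing
  coordinates at all \<open>b\<close> with \<open>q a b = l\<close>; the commutation relation with \<open>\<phi> v_i\<close>, whose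
  coordinate at \<open>a\<close> is nonzero, then kills the remaining coordinates of \<open>w\<close>.\<close>

lemma graut_support_card_le:
  assumes aut: "\<phi> \<in> qgraut I q" and ia: "i \<in> I" "a \<in> I" and ne: "\<phi> (qgen i) (unit_exp a) \<noteq> 0"
  shows "card {j \<in> I. q i j = l} \<le> card {b \<in> I. q a b = l}"
proof (rule ccontr)
  let ?J = "{j \<in> I. q i j = l}" and ?B = "{b \<in> I. q a b = l}"
  let ?G = "\<lambda>b j. \<phi> (qgen j) (unit_exp b)"
  assume "\<not> ?thesis"
  then obtain x where x: "\<exists>j\<in>?J. x j \<noteq> 0" "\<forall>b\<in>?B. (\<Sum>j\<in>?J. x j * ?G b j) = 0"
    using underdetermined_linear_system[of ?B ?J ?G] finite_index by auto
  define u where "u = (\<lambda>c. \<Sum>j\<in>?J. x j * qgen j c)"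
  have fin: "finite ?J" using finite_index by simp
  have u: "u \<in> qcarrier I"
    unfolding u_def using fin by (rule qcarrier_sum) (simp add: qcarrier_scale)
  have phi_u: "\<phi> u = (\<lambda>c. \<Sum>j\<in>?J. x j * \<phi> (qgen j) c)"
    unfolding u_def using fin
    by (subst graut_sum[OF aut]) (simp_all add: qcarrier_scale graut_scale[OF aut])
  define w where "w = (\<lambda>b. \<phi> u (unit_exp b))"
  define v where "v = \<phi> (qgen i)"
  have w: "w b = (\<Sum>j\<in>?J. x j * ?G b j)" for b by (simp add: w_def phi_u)
  have va: "v (unit_exp a) \<noteq> 0" using ne by (simp add: v_def)
  have "(1 - l) * v (unit_exp a) * (x j * ?G a j) = 0" if "j \<in> ?J" for j
    using graut_coefficient_relation(2)[OF aut ia(1) _ ia(2) ia(2), of j] that by (auto simp: v_def)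
  then have "(1 - l) * v (unit_exp a) * w a = 0"
    unfolding w sum_distrib_left by (rule sum.neutral[rule_format])
  \<comment> \<open>If \<open>l = 1\<close>, then \<open>a\<close> itself belongs to
    \<open>?B\<close> because \<open>q a a = 1\<close>, and the choice of \<open>x\<close> applies;
    otherwise the factor \<open>1 - l\<close> cancels.\<close>
  then have wa: "w a = 0"
    using va w x(2) ia diag[of a] by auto
  have "w b = 0" if b: "b \<in> I" for b
  proof (cases "q a b = l")
    case True
    then show ?thesis using x(2) w b by simp
  next
    case False
    show ?thesis
    proof (cases "a = b")
      case False
      have "(q a b - l) * v (unit_exp a) * (x j * ?G b j) = (l * q a b - 1) * v (unit_exp b) * (x j * ?G a j)"
        if "j \<in> ?J" for j
        using graut_coefficient_relation(1)[OF aut ia(1) _ ia(2) b False, of j] that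
        by (simp add: v_def mult.left_commute)
      \<comment> \<open>The relation is linear in the second vector, so it passes from the single
        images to \<open>w\<close>. Its right side then vanishes because
        \<open>w a = 0\<close>.\<close>
      then have "(q a b - l) * v (unit_exp a) * w b = (l * q a b - 1) * v (unit_exp b) * w a"
        unfolding w sum_distrib_left by (rule sum.cong[OF refl])
      then show ?thesis using wa va \<open>q a b \<noteq> l\<close> by simp
    qed (use wa in simp)
  qed
  moreover have "qhomog I 1 u"
    unfolding qhomog_def
  proof (intro allI impI)
    fix c assume "u c \<noteq> 0"
    then obtain j where "j \<in> ?J" "x j * qgen j c \<noteq> 0"
      unfolding u_def by (rule sum.not_neutral_contains_not_neutral)
    then show "qdeg I c = 1"
      using qdeg_unit_exp[OF finite_index] by (auto simp: qmono_def split: if_splits)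
  qed
  then have "qhomog I 1 (\<phi> u)" using graut_homog[OF aut u] by blast
  ultimately have "\<phi> u c = 0" for c
    using deg_one_support[OF graut_in_qcarrier[OF aut u], of c] by (auto simp: w_def)
  then have "\<phi> u = \<phi> (\<lambda>_. 0)" by (simp add: graut_zero[OF aut] fun_eq_iff)
  then have "u = (\<lambda>_. 0)" using graut_inj[OF aut u] by simp
  \<comment> \<open>The generators are linearly independent, so \<open>u\<close> determines the
    coefficients \<open>x\<close>, which are not all zero.\<close>
  moreover have "u (unit_exp j) = x j" if "j \<in> ?J" for j
  proof -
    have "u (unit_exp j) = (\<Sum>k\<in>?J. if j = k then x k else 0)"
      unfolding u_def by (intro sum.cong) (auto simp: qmono_def)
    then show ?thesis using that fin by simp
  qed
  ultimately show False using x(1) by auto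
qed

text \<open>The estimates for all scalars together give equal multisets of entries for the rows
  \<open>i\<close> and \<open>a\<close>, and equal multisets over \<open>I\<close> differ by a
  permutation of \<open>I\<close>.\<close>

lemma graut_support_row_perm:
  assumes aut: "\<phi> \<in> qgraut I q" and ia: "i \<in> I" "a \<in> I" and ne: "\<phi> (qgen i) (unit_exp a) \<noteq> 0"
  obtains p where "p permutes I" "\<forall>m\<in>I. q i m = q a (p m)"
  using image_mset_eq_implies_permutes[OF finite_index
      image_mset_eqI_card_le[OF finite_index graut_support_card_le[OF assms]]]
  by blast

end

section \<open>Extending an automorphism of one block\<close>

definition exp_part :: "nat set \<Rightarrow> (nat \<Rightarrow> nat) \<Rightarrow> nat \<Rightarrow> nat" where
  "exp_part X a = (\<lambda>i. if i \<in> X then a i else 0)"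

lemma supported_in_exp_part [simp]: "supported_in X (exp_part X a)"
  by (simp add: supported_in_def exp_part_def)

lemma exp_part_add: "exp_part X (\<lambda>i. a i + b i) = (\<lambda>i. exp_part X a i + exp_part X b i)"
  by (auto simp: exp_part_def)

lemma exp_part_id: "supported_in X a \<Longrightarrow> exp_part X a = a"
  by (auto simp: exp_part_def supported_in_def)

lemma exp_part_disjoint: "\<lbrakk>supported_in Y a; X \<inter> Y = {}\<rbrakk> \<Longrightarrow> exp_part X a = (\<lambda>_. 0)"
  by (auto simp: exp_part_def supported_in_def fun_eq_iff)

lemma qtwist_supported:
  assumes "finite I" "X \<subseteq> I" "Y \<subseteq> I" "supported_in X a" "supported_in Y b"
  shows "qtwist I q a b = (\<Prod>i\<in>X. \<Prod>j\<in>Y. if j < i then q j i ^ (a i * b j) else 1)"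
proof -
  have "qtwist I q a b = (\<Prod>i\<in>I. \<Prod>j\<in>Y. if j < i then q j i ^ (a i * b j) else 1)"
    unfolding qtwist_alt[OF assms(1)] using assms
    by (intro prod.cong refl prod.mono_neutral_right) (auto simp: supported_in_def)
  also have "\<dots> = (\<Prod>i\<in>X. \<Prod>j\<in>Y. if j < i then q j i ^ (a i * b j) else 1)"
    using assms by (intro prod.mono_neutral_right) (auto simp: supported_in_def intro!: prod.neutral)
  finally show ?thesis .
qed

text \<open>The index \<open>d\<close> is a chosen representative, so that \<open>q d b\<close>
  names the common entry of the rows of \<open>D\<close> in an outside column \<open>b\<close>.
  \<open>D\<close> may be any nonempty set of indices with this constancy; equivalence classes do
  not enter here.\<close>

locale quantum_block = quantum_matrix +
  fixes D :: "nat set" and d :: nat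
  assumes block_subset: "D \<subseteq> I" and d_in: "d \<in> D"
    and cross: "\<lbrakk>a \<in> D; b \<in> I - D\<rbrakk> \<Longrightarrow> q a b = q d b"
begin

text \<open>\<open>slice b f\<close> is the coefficient of \<open>v^b\<close> (\<open>b\<close> supported outside \<open>D\<close>) when the whole algebra is
  viewed as the free left module over the block algebra on these monomials; the division is due to
  \<open>v^c v^b = qtwist c b v^(c+b)\<close>.  \<open>extend \<phi>\<close> applies \<open>\<phi>\<close> to all these coefficients.\<close>

definition slice :: "(nat \<Rightarrow> nat) \<Rightarrow> ((nat \<Rightarrow> nat) \<Rightarrow> 'a) \<Rightarrow> (nat \<Rightarrow> nat) \<Rightarrow> 'a" where
  "slice b f = (\<lambda>c. if supported_in D c then f (\<lambda>i. c i + b i) / qtwist I q c b else 0)"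

definition extend :: "(((nat \<Rightarrow> nat) \<Rightarrow> 'a) \<Rightarrow> (nat \<Rightarrow> nat) \<Rightarrow> 'a) \<Rightarrow>
    ((nat \<Rightarrow> nat) \<Rightarrow> 'a) \<Rightarrow> (nat \<Rightarrow> nat) \<Rightarrow> 'a" where
  "extend \<phi> = (\<lambda>f\<in>qcarrier I. \<lambda>e. if supported_in I e then
     qtwist I q (exp_part D e) (exp_part (I - D) e) *
       \<phi> (slice (exp_part (I - D) e) f) (exp_part D e) else 0)"

lemma finite_block: "finite D"
  using block_subset finite_index by (rule finite_subset)

lemma exp_part_sum: "supported_in I e \<Longrightarrow> (\<lambda>i. exp_part D e i + exp_part (I - D) e i) = e"
  using block_subset by (auto simp: exp_part_def supported_in_def fun_eq_iff)

lemma exp_part_parts: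
  assumes "supported_in D c" "supported_in (I - D) b"
  shows "exp_part D (\<lambda>i. c i + b i) = c" "exp_part (I - D) (\<lambda>i. c i + b i) = b"
proof -
  have "exp_part D b = (\<lambda>_. 0)" "exp_part (I - D) c = (\<lambda>_. 0)"
    using assms by (auto intro: exp_part_disjoint)
  then show "exp_part D (\<lambda>i. c i + b i) = c" "exp_part (I - D) (\<lambda>i. c i + b i) = b"
    using assms by (simp_all add: exp_part_add exp_part_id)
qed

lemma slice_in_qcarrier:
  assumes "f \<in> qcarrier I"
  shows "slice b f \<in> qcarrier D"
proof -
  have "inj (\<lambda>c i. c i + b i)" by (auto intro!: injI simp: fun_eq_iff)
  moreover have "finite {a. f a \<noteq> 0}" using assms by (simp add: qcarrier_iff)
  ultimately have "finite ((\<lambda>c i. c i + b i) -` {a. f a \<noteq> 0})" by (intro finite_vimageI)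
  then have "finite {c. slice b f c \<noteq> 0}"
    by (rule rev_finite_subset) (auto simp: slice_def)
  then show ?thesis by (auto simp: qcarrier_iff slice_def)
qed

text \<open>Every exponent splits into a part in \<open>D\<close> and a part outside, so the slices
  see every coefficient. Identities for \<open>extend\<close> are proved this way, since slicing
  turns \<open>extend \<phi>\<close> into \<open>\<phi>\<close>.\<close>

lemma slice_eqI:
  assumes "f \<in> qcarrier I" "g \<in> qcarrier I"
    and "\<And>b. supported_in (I - D) b \<Longrightarrow> slice b f = slice b g"
  shows "f = g"
proof
  fix e
  show "f e = g e"
  proof (cases "supported_in I e")
    case True
    have "slice (exp_part (I - D) e) f (exp_part D e) = slice (exp_part (I - D) e) g (exp_part D e)"
      using assms(3) by simp
    then show ?thesis using exp_part_sum[OF True] by (simp add: slice_def)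
  qed (simp add: qcarrier_eq_0[OF assms(1)] qcarrier_eq_0[OF assms(2)])
qed

lemma slice_add: "slice b (\<lambda>a. f a + g a) = (\<lambda>a. slice b f a + slice b g a)"
  by (auto simp: slice_def add_divide_distrib)

lemma slice_scale: "slice b (\<lambda>a. c * f a) = (\<lambda>a. c * slice b f a)"
  by (auto simp: slice_def)

lemma slice_block:
  assumes "f \<in> qcarrier D" "supported_in (I - D) b"
  shows "slice b f = (if b = (\<lambda>_. 0) then f else (\<lambda>_. 0))"
proof (cases "b = (\<lambda>_. 0)")
  case True
  then show ?thesis by (auto simp: slice_def qcarrier_eq_0[OF assms(1)])
next
  case False
  have "\<not> supported_in D b"
    using assms(2) False supported_in_disjoint[of D b "I - D"] by auto
  then show ?thesis using False by (auto simp: slice_def qcarrier_eq_0[OF assms(1)])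
qed

text \<open>Elements free of the variables of \<open>D\<close> have scalar coefficients over the
  block algebra. Block automorphisms fix scalars, hence their extensions fix these elements.\<close>

lemma slice_complement:
  assumes "f \<in> qcarrier (I - D)"
  shows "slice b f = (\<lambda>c. f b * qone c)"
proof
  fix c
  show "slice b f c = f b * qone c"
  proof (cases "c = (\<lambda>_. 0)")
    case True
    then show ?thesis by (simp add: slice_def qone_def)
  next
    case False
    have "f (\<lambda>i. c i + b i) = 0" if "supported_in D c"
    proof -
      have "\<not> supported_in (I - D) c"
        using that False supported_in_disjoint[of D c "I - D"] by blast
      then show ?thesis using qcarrier_eq_0[OF assms, of "\<lambda>i. c i + b i"] by simp
    qed
    then show ?thesis using False by (simp add: slice_def qone_def)
  qed
qed

text \<open>\<open>v^b v^y = twist_char b ^ (deg y) v^y v^b\<close> for \<open>b\<close> outside and \<open>y\<close> inside the block.\<close>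

definition twist_char :: "(nat \<Rightarrow> nat) \<Rightarrow> 'a" where
  "twist_char b = (\<Prod>i\<in>I - D. q d i ^ b i)"

lemma qtwist_swap:
  assumes "supported_in (I - D) b" "supported_in D y"
  shows "qtwist I q b y = twist_char b ^ qdeg D y * qtwist I q y b"
proof -
  have "twist_char b ^ qdeg D y = (\<Prod>j\<in>D. \<Prod>i\<in>I - D. q d i ^ (b i * y j))"
    by (simp add: twist_char_def qdeg_def power_sum prod_power_distrib power_mult)
  also have "\<dots> = (\<Prod>i\<in>I - D. \<Prod>j\<in>D. q d i ^ (b i * y j))" by (rule prod.swap)
  finally have char: "twist_char b ^ qdeg D y = (\<Prod>i\<in>I - D. \<Prod>j\<in>D. q d i ^ (b i * y j))" .
  have "qtwist I q y b = (\<Prod>j\<in>D. \<Prod>i\<in>I - D. if i < j then q i j ^ (y j * b i) else 1)"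
    using finite_index block_subset assms by (simp add: qtwist_supported)
  also have "\<dots> = (\<Prod>i\<in>I - D. \<Prod>j\<in>D. if i < j then q i j ^ (y j * b i) else 1)"
    by (rule prod.swap)
  finally have twist: "qtwist I q y b = \<dots>" .
  have "qtwist I q b y = (\<Prod>i\<in>I - D. \<Prod>j\<in>D. if j < i then q j i ^ (b i * y j) else 1)"
    using finite_index block_subset assms by (simp add: qtwist_supported)
  also have "\<dots> = (\<Prod>i\<in>I - D. \<Prod>j\<in>D.
      q d i ^ (b i * y j) * (if i < j then q i j ^ (y j * b i) else 1))"
  proof (intro prod.cong refl)
    fix i j assume i: "i \<in> I - D" and j: "j \<in> D"
    then have "i \<noteq> j" by auto
    \<comment> \<open>The column condition turns \<open>q j i\<close> into \<open>q d i\<close>.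
      Hence a pair with \<open>j < i\<close> gives the character factor on both sides, while for
      \<open>i < j\<close> that factor cancels against \<open>q i j\<close>.\<close>
    have "q d i * q i j = 1" using cross[OF j i] skew[of j i] i j block_subset by auto
    then have "q d i ^ m * q i j ^ m = 1" for m by (simp add: power_mult_distrib[symmetric])
    then show "(if j < i then q j i ^ (b i * y j) else 1) =
        q d i ^ (b i * y j) * (if i < j then q i j ^ (y j * b i) else 1)"
      using \<open>i \<noteq> j\<close> cross[OF j i] by (simp add: mult.commute)
  qed
  finally show ?thesis by (simp add: char twist prod.distrib)
qed

text \<open>Of the factors given by bilinearity, the one for \<open>x\<close> and \<open>b'\<close>
  cancels, and the one for \<open>b\<close> and \<open>y\<close> is reversed by
  \<open>qtwist_swap\<close>. The denominator that remains is the normalisation of the two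
  slices.\<close>

lemma qtwist_parts:
  assumes "supported_in D x" "supported_in D y" "supported_in (I - D) b" "supported_in (I - D) b'"
  shows "qtwist I q (\<lambda>i. x i + b i) (\<lambda>i. y i + b' i) / qtwist I q (\<lambda>i. x i + y i) (\<lambda>i. b i + b' i) =
    qtwist D q x y * qtwist I q b b' * twist_char b ^ qdeg D y / (qtwist I q x b * qtwist I q y b')"
  using assms
  by (simp add: qtwist_add_left[OF finite_index] qtwist_add_right[OF finite_index] qtwist_swap
      qtwist_subset[OF finite_index block_subset, symmetric] field_simps)

text \<open>With \<open>f\<close> and \<open>g\<close> written as sums of block elements times
  outside monomials, the term at \<open>b\<close> in \<open>f\<close> meets the term at
  \<open>e - b\<close> in \<open>g\<close>. Moving v^b past the block coefficient of
  \<open>g\<close> produces the character, and multiplying the two outside monomials gives the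
  remaining twist.\<close>

lemma slice_qmult:
  assumes e: "supported_in (I - D) e"
  shows "slice e (qmult I q f g) = (\<lambda>c. \<Sum>b\<in>{b. (\<forall>i. b i \<le> e i) \<and> supported_in (I - D) b}.
    qtwist I q b (\<lambda>i. e i - b i) *
      qmult D q (slice b f) (\<lambda>y. twist_char b ^ qdeg D y * slice (\<lambda>i. e i - b i) g y) c)"
proof
  fix c
  let ?Y = "{b. (\<forall>i. b i \<le> e i) \<and> supported_in (I - D) b}"
  let ?rhs = "\<Sum>b\<in>?Y. qtwist I q b (\<lambda>i. e i - b i) *
      qmult D q (slice b f) (\<lambda>y. twist_char b ^ qdeg D y * slice (\<lambda>i. e i - b i) g y) c"
  show "slice e (qmult I q f g) c = ?rhs"
  proof (cases "supported_in D c")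
    case False
    then show ?thesis by (simp add: slice_def qmult_eq)
  next
    case c: True
    let ?X = "{x. (\<forall>i. x i \<le> c i) \<and> supported_in D x}"
    let ?Z = "{a. (\<forall>i. a i \<le> c i + e i) \<and> supported_in I a}"
    let ?F = "\<lambda>a. f a * g (\<lambda>i. c i + e i - a i) * qtwist I q a (\<lambda>i. c i + e i - a i) / qtwist I q c e"
    let ?G = "\<lambda>x b. qtwist I q b (\<lambda>i. e i - b i) * (slice b f x *
        (twist_char b ^ qdeg D (\<lambda>i. c i - x i) * slice (\<lambda>i. e i - b i) g (\<lambda>i. c i - x i)) *
        qtwist D q x (\<lambda>i. c i - x i))"
    have ce: "supported_in I (\<lambda>i. c i + e i)"
      using supported_in_mono[OF c block_subset] supported_in_mono[OF e Diff_subset] by simp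
    have "slice e (qmult I q f g) c = (\<Sum>a\<in>?Z. ?F a)"
      using c ce by (simp add: slice_def qmult_eq sum_divide_distrib)
    also have "\<dots> = (\<Sum>(b, x)\<in>?Y \<times> ?X. ?G x b)"
    \<comment> \<open>Splitting and adding identify an exponent below \<open>c + e\<close> with a
      pair: one below \<open>e\<close> outside \<open>D\<close>, one below \<open>c\<close>
      inside.\<close>
    proof (rule sum.reindex_bij_witness[where i = "\<lambda>(b, x) i. x i + b i"
          and j = "\<lambda>a. (exp_part (I - D) a, exp_part D a)"])
      fix a assume a: "a \<in> ?Z"
      then show "(\<lambda>(b, x) i. x i + b i) (exp_part (I - D) a, exp_part D a) = a"
        by (simp add: exp_part_sum)
      have le: "exp_part D a i \<le> c i" "exp_part (I - D) a i \<le> e i" for i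
        using a c e block_subset
        by (auto simp: exp_part_def supported_in_def dest: spec[of _ i])
      then show "(exp_part (I - D) a, exp_part D a) \<in> ?Y \<times> ?X" by simp
      define x y b b' where "x = exp_part D a" and "y = (\<lambda>i. c i - x i)"
        and "b = exp_part (I - D) a" and "b' = (\<lambda>i. e i - b i)"
      have sup: "supported_in D x" "supported_in D y" "supported_in (I - D) b" "supported_in (I - D) b'"
        using c e by (simp_all add: x_def y_def b_def b'_def supported_in_diff)
      have eqs: "a = (\<lambda>i. x i + b i)" "(\<lambda>i. c i + e i - a i) = (\<lambda>i. y i + b' i)"
        "c = (\<lambda>i. x i + y i)" "e = (\<lambda>i. b i + b' i)"
      proof -
        show a_eq: "a = (\<lambda>i. x i + b i)" using a exp_part_sum[of a] by (simp add: x_def b_def)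
        show c_eq: "c = (\<lambda>i. x i + y i)" and e_eq: "e = (\<lambda>i. b i + b' i)"
          using le by (simp_all add: fun_eq_iff x_def y_def b_def b'_def)
        show "(\<lambda>i. c i + e i - a i) = (\<lambda>i. y i + b' i)"
          by (subst a_eq, subst c_eq, subst e_eq) (simp add: fun_eq_iff)
      qed
      have "?F a = f (\<lambda>i. x i + b i) * g (\<lambda>i. y i + b' i) *
          (qtwist I q (\<lambda>i. x i + b i) (\<lambda>i. y i + b' i) / qtwist I q (\<lambda>i. x i + y i) (\<lambda>i. b i + b' i))"
        by (simp only: eqs(2)) (simp add: eqs(1,3,4)[symmetric])
      also have "\<dots> = ?G x b"
        unfolding qtwist_parts[OF sup] y_def[symmetric] b'_def[symmetric]
        using sup by (simp add: slice_def)
      finally show "(case (exp_part (I - D) a, exp_part D a) of (b, x) \<Rightarrow> ?G x b) = ?F a"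
        by (simp add: x_def b_def)
    next
      fix p assume "p \<in> ?Y \<times> ?X"
      then obtain b x where p: "p = (b, x)" "b \<in> ?Y" "x \<in> ?X" by blast
      then show "(exp_part (I - D) ((\<lambda>(b, x) i. x i + b i) p),
          exp_part D ((\<lambda>(b, x) i. x i + b i) p)) = p"
        by (simp add: exp_part_parts)
      show "(\<lambda>(b, x) i. x i + b i) p \<in> ?Z"
        using p supported_in_mono[of D x, OF _ block_subset] supported_in_mono[of "I - D" b, OF _ Diff_subset]
        by (simp add: add_mono)
    qed
    also have "\<dots> = (\<Sum>b\<in>?Y. \<Sum>x\<in>?X. ?G x b)" by (simp add: sum.cartesian_product)
    also have "\<dots> = ?rhs"
      using c by (simp add: qmult_eq sum_distrib_left)
    finally show ?thesis .
  qed
qed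

context
  fixes \<phi> :: "((nat \<Rightarrow> nat) \<Rightarrow> 'a) \<Rightarrow> (nat \<Rightarrow> nat) \<Rightarrow> 'a"
  assumes block_aut: "\<phi> \<in> qgraut D q"
begin

text \<open>Only the finitely many outside parts of exponents of \<open>f\<close> give nonzero
  slices, and the image of each slice has finite support.\<close>

lemma extend_in_qcarrier:
  assumes f: "f \<in> qcarrier I"
  shows "extend \<phi> f \<in> qcarrier I"
proof -
  let ?B = "exp_part (I - D) ` {a. f a \<noteq> 0}"
  let ?S = "(\<lambda>(b, c) i. c i + b i) ` (SIGMA b:?B. {c. \<phi> (slice b f) c \<noteq> 0})"
  have in_D: "\<phi> (slice b f) \<in> qcarrier D" for b
    using graut_in_qcarrier[OF block_aut slice_in_qcarrier[OF f]] .
  have "e \<in> ?S" if e: "extend \<phi> f e \<noteq> 0" for e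
  proof -
    let ?b = "exp_part (I - D) e"
    have sup: "supported_in I e" and ne: "\<phi> (slice ?b f) (exp_part D e) \<noteq> 0"
      using e f by (simp_all add: extend_def split: if_splits)
    have "slice ?b f \<noteq> (\<lambda>_. 0)" using ne graut_zero[OF block_aut] by auto
    then obtain c where c: "supported_in D c" "f (\<lambda>i. c i + ?b i) \<noteq> 0"
      by (auto simp: slice_def fun_eq_iff split: if_splits)
    then have "?b \<in> ?B"
      using exp_part_parts(2)[OF c(1), of ?b] by (intro image_eqI[of _ _ "\<lambda>i. c i + ?b i"]) auto
    then show ?thesis
      using exp_part_sum[OF sup] ne by (intro image_eqI[of _ _ "(?b, exp_part D e)"]) auto
  qed
  then have "{e. extend \<phi> f e \<noteq> 0} \<subseteq> ?S" by blast
  moreover have "finite ?S"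
    using f in_D by (intro finite_imageI finite_SigmaI) (simp_all add: qcarrier_iff)
  ultimately have "finite {e. extend \<phi> f e \<noteq> 0}" by (rule finite_subset)
  then show ?thesis using f by (simp add: qcarrier_iff extend_def)
qed

lemma slice_extend:
  assumes "f \<in> qcarrier I" "supported_in (I - D) b"
  shows "slice b (extend \<phi> f) = \<phi> (slice b f)"
proof
  fix c
  show "slice b (extend \<phi> f) c = \<phi> (slice b f) c"
  proof (cases "supported_in D c")
    case True
    have "supported_in I c" "supported_in I b"
      using supported_in_mono[OF True block_subset] supported_in_mono[OF assms(2) Diff_subset] by auto
    then have "extend \<phi> f (\<lambda>i. c i + b i) = qtwist I q c b * \<phi> (slice b f) c"
      using assms True by (simp add: extend_def exp_part_parts)
    then show ?thesis using True by (simp add: slice_def[of b "extend \<phi> f"])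
  next
    case False
    then show ?thesis
      using qcarrier_eq_0[OF graut_in_qcarrier[OF block_aut slice_in_qcarrier[OF assms(1)]] False]
      by (simp add: slice_def[of b "extend \<phi> f"])
  qed
qed

lemma extend_block:
  assumes f: "f \<in> qcarrier D"
  shows "extend \<phi> f = \<phi> f"
proof (rule slice_eqI)
  note sub = subsetD[OF qcarrier_mono[OF block_subset]]
  note in_D = graut_in_qcarrier[OF block_aut f]
  show "extend \<phi> f \<in> qcarrier I" "\<phi> f \<in> qcarrier I"
    using extend_in_qcarrier[OF sub[OF f]] sub[OF in_D] .
  fix b assume b: "supported_in (I - D) b"
  show "slice b (extend \<phi> f) = slice b (\<phi> f)"
    unfolding slice_extend[OF sub[OF f] b] slice_block[OF f b] slice_block[OF in_D b]
    using graut_zero[OF block_aut] by simp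
qed

lemma extend_complement:
  assumes f: "f \<in> qcarrier (I - D)"
  shows "extend \<phi> f = f"
proof (rule slice_eqI)
  show fI: "f \<in> qcarrier I" using f qcarrier_mono[OF Diff_subset] by (rule rev_subsetD)
  show "extend \<phi> f \<in> qcarrier I" using extend_in_qcarrier[OF fI] .
  fix b assume b: "supported_in (I - D) b"
  show "slice b (extend \<phi> f) = slice b f"
    unfolding slice_extend[OF fI b] slice_complement[OF f]
    using graut_scale[OF block_aut qone_in_qcarrier] graut_one[OF block_aut] by simp
qed

text \<open>On slices both sides become the sum in \<open>slice_qmult\<close>. \<open>\<phi>\<close>
  passes through the sum and the block products, and through the degree-dependent factor by
  \<open>graut_power_deg\<close>.\<close>

lemma extend_qmult:
  assumes f: "f \<in> qcarrier I" and g: "g \<in> qcarrier I"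
  shows "extend \<phi> (qmult I q f g) = qmult I q (extend \<phi> f) (extend \<phi> g)"
proof (rule slice_eqI)
  note in_I = extend_in_qcarrier[OF f] extend_in_qcarrier[OF g]
  show fg: "extend \<phi> (qmult I q f g) \<in> qcarrier I" "qmult I q (extend \<phi> f) (extend \<phi> g) \<in> qcarrier I"
    using qmult_qcarrier[OF finite_index f g] qmult_qcarrier[OF finite_index in_I]
    by (simp_all add: extend_in_qcarrier)
  fix e assume e: "supported_in (I - D) e"
  let ?Y = "{b. (\<forall>i. b i \<le> e i) \<and> supported_in (I - D) b}"
  let ?g = "\<lambda>b y. twist_char b ^ qdeg D y * slice (\<lambda>i. e i - b i) g y"
  have fin: "finite ?Y" using finite_index by (intro finite_exponents_below) simp
  have sl: "slice b f \<in> qcarrier D" "?g b \<in> qcarrier D" for b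
    using f g by (simp_all add: slice_in_qcarrier qcarrier_scale)
  have fgD: "qmult D q (slice b f) (?g b) \<in> qcarrier D" for b
    using sl by (intro qmult_qcarrier finite_block)
  have "slice e (extend \<phi> (qmult I q f g)) = \<phi> (slice e (qmult I q f g))"
    using e qmult_qcarrier[OF finite_index f g] by (simp add: slice_extend)
  also have "\<dots> = \<phi> (\<lambda>c. \<Sum>b\<in>?Y. qtwist I q b (\<lambda>i. e i - b i) * qmult D q (slice b f) (?g b) c)"
    using e by (simp add: slice_qmult)
  also have "\<dots> = (\<lambda>c. \<Sum>b\<in>?Y. \<phi> (\<lambda>c. qtwist I q b (\<lambda>i. e i - b i) * qmult D q (slice b f) (?g b) c) c)"
    by (rule graut_sum[OF block_aut fin qcarrier_scale[OF fgD]])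
  also have "\<dots> = (\<lambda>c. \<Sum>b\<in>?Y. qtwist I q b (\<lambda>i. e i - b i) *
      qmult D q (slice b (extend \<phi> f))
        (\<lambda>y. twist_char b ^ qdeg D y * slice (\<lambda>i. e i - b i) (extend \<phi> g) y) c)"
  proof (intro ext sum.cong refl)
    fix c b assume b: "b \<in> ?Y"
    have "\<phi> (\<lambda>c. qtwist I q b (\<lambda>i. e i - b i) * qmult D q (slice b f) (?g b) c) c =
        qtwist I q b (\<lambda>i. e i - b i) * qmult D q (\<phi> (slice b f)) (\<phi> (?g b)) c"
      using graut_scale[OF block_aut fgD] graut_mult[OF block_aut sl] by simp
    also have "\<phi> (?g b) = (\<lambda>y. twist_char b ^ qdeg D y * \<phi> (slice (\<lambda>i. e i - b i) g) y)"
      using g by (intro graut_power_deg[OF block_aut] slice_in_qcarrier)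
    also have "\<phi> (slice (\<lambda>i. e i - b i) g) = slice (\<lambda>i. e i - b i) (extend \<phi> g)"
      using g e by (simp add: slice_extend supported_in_diff)
    also have "\<phi> (slice b f) = slice b (extend \<phi> f)" using f b by (simp add: slice_extend)
    finally show "\<phi> (\<lambda>c. qtwist I q b (\<lambda>i. e i - b i) * qmult D q (slice b f) (?g b) c) c =
        qtwist I q b (\<lambda>i. e i - b i) * qmult D q (slice b (extend \<phi> f))
        (\<lambda>y. twist_char b ^ qdeg D y * slice (\<lambda>i. e i - b i) (extend \<phi> g) y) c" .
  qed
  also have "\<dots> = slice e (qmult I q (extend \<phi> f) (extend \<phi> g))"
    using e by (simp add: slice_qmult)
  finally show "slice e (extend \<phi> (qmult I q f g)) = slice e (qmult I q (extend \<phi> f) (extend \<phi> g))" .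
qed

lemma extend_homog:
  assumes f: "f \<in> qcarrier I" and hom: "qhomog I m f"
  shows "qhomog I m (extend \<phi> f)"
  unfolding qhomog_def
proof (intro allI impI)
  fix e assume ne: "extend \<phi> f e \<noteq> 0"
  let ?b = "exp_part (I - D) e" and ?c = "exp_part D e"
  have sup: "supported_in I e" and ne': "\<phi> (slice ?b f) ?c \<noteq> 0"
    using ne f by (simp_all add: extend_def split: if_splits)
  have deg: "qdeg D c + qdeg I ?b = m" if "slice ?b f c \<noteq> 0" for c
  proof -
    have c: "supported_in D c" "f (\<lambda>i. c i + ?b i) \<noteq> 0" using that by (auto simp: slice_def split: if_splits)
    then have "qdeg I (\<lambda>i. c i + ?b i) = m" using hom by (simp add: qhomog_def)
    then show ?thesis using qdeg_subset[OF finite_index block_subset c(1)] by (simp add: qdeg_add)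
  qed
  have "slice ?b f \<noteq> (\<lambda>_. 0)" using ne' graut_zero[OF block_aut] by auto
  \<comment> \<open>The slice is homogeneous of degree \<open>m\<close> minus the degree of the
    outside part. That degree is read off from some \<open>c\<close> in its support, which avoids
    subtracting natural numbers.\<close>
  then obtain c where c: "slice ?b f c \<noteq> 0" by (auto simp: fun_eq_iff)
  have "qhomog D (qdeg D c) (slice ?b f)"
    unfolding qhomog_def using deg deg[OF c] by auto
  then have "qhomog D (qdeg D c) (\<phi> (slice ?b f))"
    using f by (intro graut_homog[OF block_aut] slice_in_qcarrier)
  then have "qdeg D ?c = qdeg D c" using ne' by (simp add: qhomog_def)
  then have "qdeg I ?c + qdeg I ?b = m"
    using deg[OF c] qdeg_subset[OF finite_index block_subset supported_in_exp_part[of D e]] by simp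
  then show "qdeg I e = m"
    using exp_part_sum[OF sup] qdeg_add[of I ?c ?b] by simp
qed

lemma extend_add:
  assumes f: "f \<in> qcarrier I" and g: "g \<in> qcarrier I"
  shows "extend \<phi> (\<lambda>a. f a + g a) = (\<lambda>a. extend \<phi> f a + extend \<phi> g a)"
proof (rule slice_eqI)
  show "extend \<phi> (\<lambda>a. f a + g a) \<in> qcarrier I"
    using extend_in_qcarrier[OF qcarrier_add[OF f g]] .
  show "(\<lambda>a. extend \<phi> f a + extend \<phi> g a) \<in> qcarrier I"
    using qcarrier_add[OF extend_in_qcarrier[OF f] extend_in_qcarrier[OF g]] .
  fix b assume b: "supported_in (I - D) b"
  show "slice b (extend \<phi> (\<lambda>a. f a + g a)) = slice b (\<lambda>a. extend \<phi> f a + extend \<phi> g a)"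
    unfolding slice_extend[OF qcarrier_add[OF f g] b] slice_add slice_extend[OF f b] slice_extend[OF g b]
    using graut_add[OF block_aut slice_in_qcarrier[OF f] slice_in_qcarrier[OF g]] .
qed

lemma extend_scale:
  assumes f: "f \<in> qcarrier I"
  shows "extend \<phi> (\<lambda>a. c * f a) = (\<lambda>a. c * extend \<phi> f a)"
proof (rule slice_eqI)
  show "extend \<phi> (\<lambda>a. c * f a) \<in> qcarrier I"
    using extend_in_qcarrier[OF qcarrier_scale[OF f]] .
  show "(\<lambda>a. c * extend \<phi> f a) \<in> qcarrier I"
    using qcarrier_scale[OF extend_in_qcarrier[OF f]] .
  fix b assume b: "supported_in (I - D) b"
  show "slice b (extend \<phi> (\<lambda>a. c * f a)) = slice b (\<lambda>a. c * extend \<phi> f a)"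
    unfolding slice_extend[OF qcarrier_scale[OF f] b] slice_scale slice_extend[OF f b]
    using graut_scale[OF block_aut slice_in_qcarrier[OF f]] .
qed

end

text \<open>Used for an automorphism and its inverse in both orders, this makes the extension
  bijective.\<close>

lemma extend_extend:
  assumes aut: "\<phi> \<in> qgraut D q" "\<psi> \<in> qgraut D q" and inv: "\<forall>f\<in>qcarrier D. \<psi> (\<phi> f) = f"
    and f: "f \<in> qcarrier I"
  shows "extend \<psi> (extend \<phi> f) = f"
proof (rule slice_eqI)
  note in_I = extend_in_qcarrier[OF aut(1) f]
  show "extend \<psi> (extend \<phi> f) \<in> qcarrier I" using extend_in_qcarrier[OF aut(2) in_I] .
  fix b assume b: "supported_in (I - D) b"
  show "slice b (extend \<psi> (extend \<phi> f)) = slice b f"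
    unfolding slice_extend[OF aut(2) in_I b] slice_extend[OF aut(1) f b]
    using bspec[OF inv slice_in_qcarrier[OF f]] .
qed (rule f)

lemma extend_bij:
  assumes aut: "\<phi> \<in> qgraut D q"
  shows "bij_betw (extend \<phi>) (qcarrier I) (qcarrier I)"
proof -
  define \<psi> where "\<psi> = restrict (inv_into (qcarrier D) \<phi>) (qcarrier D)"
  have inv: "\<psi> \<in> qgraut D q" unfolding \<psi>_def using graut_inverse[OF aut finite_block] .
  have l: "\<forall>f\<in>qcarrier D. \<psi> (\<phi> f) = f"
    using graut_in_qcarrier[OF aut] bij_betw_inv_into_left[OF graut_bij[OF aut]]
    by (simp add: \<psi>_def)
  have r: "\<forall>f\<in>qcarrier D. \<phi> (\<psi> f) = f"
    using bij_betw_inv_into_right[OF graut_bij[OF aut]] by (simp add: \<psi>_def)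
  show ?thesis
  proof (rule bij_betw_byWitness[where f' = "extend \<psi>"])
    show "\<forall>f\<in>qcarrier I. extend \<psi> (extend \<phi> f) = f"
      by (rule ballI) (rule extend_extend[of \<phi> \<psi>, OF aut inv l])
    show "\<forall>f\<in>qcarrier I. extend \<phi> (extend \<psi> f) = f"
      by (rule ballI) (rule extend_extend[of \<psi> \<phi>, OF inv aut r])
    show "extend \<phi> ` qcarrier I \<subseteq> qcarrier I"
      by (rule image_subsetI) (rule extend_in_qcarrier[OF aut])
    show "extend \<psi> ` qcarrier I \<subseteq> qcarrier I"
      by (rule image_subsetI) (rule extend_in_qcarrier[OF inv])
  qed
qed

lemma extend_in_qgraut:
  assumes aut: "\<phi> \<in> qgraut D q"
  shows "extend \<phi> \<in> qgraut I q"
proof -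
  have "extend \<phi> qone = qone"
    using extend_block[OF aut, of qone] graut_one[OF aut] by simp
  moreover have "extend \<phi> \<in> extensional (qcarrier I)" by (simp add: extend_def)
  ultimately show ?thesis
    by (simp add: qgraut_def extend_bij[OF aut] extend_add[OF aut] extend_scale[OF aut]
        extend_qmult[OF aut] extend_homog[OF aut])
qed

end

section \<open>Assembling the blocks into a product\<close>

lemma graut_id: "finite I \<Longrightarrow> restrict id (qcarrier I) \<in> qgraut I q"
  by (simp add: qgraut_def qcarrier_add qcarrier_scale qmult_qcarrier)

lemma graut_compose:
  assumes "finite I" and \<phi>: "\<phi> \<in> qgraut I q" and \<psi>: "\<psi> \<in> qgraut I q"
  shows "compose (qcarrier I) \<phi> \<psi> \<in> qgraut I q"
proof -
  let ?C = "qcarrier I :: ((nat \<Rightarrow> nat) \<Rightarrow> 'a) set" and ?\<chi> = "compose (qcarrier I) \<phi> \<psi>"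
  have "bij_betw ?\<chi> ?C ?C"
    using bij_betw_compose[OF graut_bij[OF \<psi>] graut_bij[OF \<phi>]] .
  moreover have "?\<chi> (\<lambda>a. f a + g a) = (\<lambda>a. ?\<chi> f a + ?\<chi> g a)" if "f \<in> ?C" "g \<in> ?C" for f g
    unfolding compose_eq[OF qcarrier_add[OF that]] compose_eq[OF that(1)] compose_eq[OF that(2)]
      graut_add[OF \<psi> that]
    using graut_add[OF \<phi> graut_in_qcarrier[OF \<psi> that(1)] graut_in_qcarrier[OF \<psi> that(2)]] .
  moreover have "?\<chi> (\<lambda>a. c * f a) = (\<lambda>a. c * ?\<chi> f a)" if "f \<in> ?C" for c f
    unfolding compose_eq[OF qcarrier_scale[OF that]] compose_eq[OF that] graut_scale[OF \<psi> that]
    using graut_scale[OF \<phi> graut_in_qcarrier[OF \<psi> that]] .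
  moreover have "?\<chi> (qmult I q f g) = qmult I q (?\<chi> f) (?\<chi> g)" if "f \<in> ?C" "g \<in> ?C" for f g
    unfolding compose_eq[OF qmult_qcarrier[OF assms(1) that]] compose_eq[OF that(1)]
      compose_eq[OF that(2)] graut_mult[OF \<psi> that]
    using graut_mult[OF \<phi> graut_in_qcarrier[OF \<psi> that(1)] graut_in_qcarrier[OF \<psi> that(2)]] .
  moreover have "?\<chi> qone = qone"
    by (simp add: compose_eq graut_one[OF \<phi>] graut_one[OF \<psi>])
  moreover have "qhomog I d (?\<chi> f)" if "f \<in> ?C" "qhomog I d f" for d f
    unfolding compose_eq[OF that(1)]
    using graut_homog[OF \<phi> graut_in_qcarrier[OF \<psi> that(1)] graut_homog[OF \<psi> that]] .
  ultimately show ?thesis unfolding qgraut_def by simp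
qed

context quantum_matrix
begin

text \<open>Induction over the blocks, composing with the extension from one more block each time.
  The clause on elements free of the variables of \<open>F\<close> carries the induction: by it, the
  automorphism built so far fixes the new block.\<close>

lemma extend_family:
  assumes "finite F" "disjoint F"
    and "\<forall>D\<in>F. D \<subseteq> I \<and> D \<noteq> {} \<and> \<Phi> D \<in> qgraut D q \<and> (\<forall>a\<in>D. \<forall>a'\<in>D. \<forall>b\<in>I - D. q a b = q a' b)"
  shows "\<exists>\<phi>\<in>qgraut I q. (\<forall>D\<in>F. \<forall>f\<in>qcarrier D. \<phi> f = \<Phi> D f) \<and> (\<forall>f\<in>qcarrier (I - \<Union>F). \<phi> f = f)"
  using assms
proof (induction F rule: finite_induct)
  case empty
  then show ?case using graut_id[OF finite_index] by (intro bexI[of _ "restrict id (qcarrier I)"]) auto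
next
  case (insert D F)
  have "disjoint F" using insert.prems(1) by (rule pairwise_subset) auto
  moreover have "\<forall>D\<in>F. D \<subseteq> I \<and> D \<noteq> {} \<and> \<Phi> D \<in> qgraut D q \<and> (\<forall>a\<in>D. \<forall>a'\<in>D. \<forall>b\<in>I - D. q a b = q a' b)"
    by (rule ballI) (rule bspec[OF insert.prems(2) insertI2])
  ultimately have "\<exists>\<phi>\<in>qgraut I q. (\<forall>D\<in>F. \<forall>f\<in>qcarrier D. \<phi> f = \<Phi> D f) \<and>
      (\<forall>f\<in>qcarrier (I - \<Union>F). \<phi> f = f)" by (rule insert.IH)
  then obtain \<phi> where \<phi>: "\<phi> \<in> qgraut I q" and spec: "(\<forall>D\<in>F. \<forall>f\<in>qcarrier D. \<phi> f = \<Phi> D f) \<and>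
      (\<forall>f\<in>qcarrier (I - \<Union>F). \<phi> f = f)" by (rule bexE)
  note fam = bspec[OF bspec[OF conjunct1[OF spec]]] and compl = bspec[OF conjunct2[OF spec]]
  have D: "D \<subseteq> I" "D \<noteq> {}" "\<Phi> D \<in> qgraut D q"
    and D_cross: "\<forall>a\<in>D. \<forall>a'\<in>D. \<forall>b\<in>I - D. q a b = q a' b"
    using bspec[OF insert.prems(2) insertI1] by - (elim conjE, assumption)+
  then obtain d where d: "d \<in> D" by blast
  interpret D: quantum_block I q D d
  proof
    show "q a b = q d b" if "a \<in> D" "b \<in> I - D" for a b
      using bspec[OF bspec[OF bspec[OF D_cross that(1)] d] that(2)] .
  qed (use D d in auto)
  define \<psi> where "\<psi> = compose (qcarrier I) (D.extend (\<Phi> D)) \<phi>"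
  have sub: "f \<in> qcarrier I" if "f \<in> qcarrier X" "X \<subseteq> I" for f :: "(nat \<Rightarrow> nat) \<Rightarrow> 'k" and X
    using qcarrier_mono[OF that(2)] that(1) by (rule subsetD)
  have disj: "D' \<inter> D = {}" if "D' \<in> F" for D'
    using insert.prems(1) insert.hyps(2) that by (auto simp: disjoint_def pairwise_def disjnt_def)
  show ?case
  proof (intro bexI[of _ \<psi>] conjI ballI)
    show "\<psi> \<in> qgraut I q"
      unfolding \<psi>_def using D.extend_in_qgraut[OF D(3)] by (intro graut_compose finite_index \<phi>)
  next
    fix D' and f :: "(nat \<Rightarrow> nat) \<Rightarrow> 'k"
    assume D': "D' \<in> insert D F" and f: "f \<in> qcarrier D'"
    have D'_props: "D' \<subseteq> I" "\<Phi> D' \<in> qgraut D' q" using bspec[OF insert.prems(2) D'] by - (elim conjE, assumption)+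
    have f_in: "f \<in> qcarrier I" using f D'_props(1) by (rule sub)
    show "\<psi> f = \<Phi> D' f"
    proof (cases "D' = D")
      case True
      \<comment> \<open>On the new block \<open>\<phi>\<close> is the identity, by disjointness, and
        the extension acts as \<open>\<Phi> D\<close>.\<close>
      have "D \<subseteq> I - \<Union>F" using D(1) disj by blast
      then have "f \<in> qcarrier (I - \<Union>F)" using f True subsetD[OF qcarrier_mono] by metis
      then have "\<phi> f = f" by (rule compl)
      then show ?thesis using D.extend_block[OF D(3)] f f_in True by (simp add: \<psi>_def compose_eq)
    next
      case False
      then have F: "D' \<in> F" using D' by simp
      \<comment> \<open>On an old block \<open>\<phi>\<close> acts as \<open>\<Phi> D'\<close> with
        values in that block, and the extension fixes these since they avoid
        \<open>D\<close>.\<close>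
      have "\<Phi> D' f \<in> qcarrier D'"
        using D'_props(2) f by (rule graut_in_qcarrier)
      moreover have "D' \<subseteq> I - D" using D'_props(1) disj[OF F] by blast
      ultimately have "\<Phi> D' f \<in> qcarrier (I - D)" by (rule subsetD[OF qcarrier_mono, rotated])
      then show ?thesis
        using fam[OF F f] f_in D.extend_complement[OF D(3)] by (simp add: \<psi>_def compose_eq)
    qed
  next
    fix f :: "(nat \<Rightarrow> nat) \<Rightarrow> 'k"
    assume f: "f \<in> qcarrier (I - \<Union>(insert D F))"
    have "f \<in> qcarrier (I - D)" "f \<in> qcarrier (I - \<Union>F)" "f \<in> qcarrier I"
      by (rule subsetD[OF qcarrier_mono f]; blast)+
    then show "\<psi> f = f" using compl[of f] D.extend_complement[OF D(3)] by (simp add: \<psi>_def compose_eq)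
  qed
qed

text \<open>The isomorphism is restriction to the blocks. By \<open>inv\<close> the restrictions are
  automorphisms of the blocks; injectivity holds because every generator lies in a block, and
  surjectivity is \<open>extend_family\<close>, which is where \<open>cross\<close> enters.\<close>

lemma Aut_gr_iso_product:
  assumes "disjoint P" "\<Union>P = I" "{} \<notin> P"
    and cross: "\<And>D. D \<in> P \<Longrightarrow> \<forall>a\<in>D. \<forall>a'\<in>D. \<forall>b\<in>I - D. q a b = q a' b"
    and inv: "\<And>D. D \<in> P \<Longrightarrow> \<forall>\<phi>\<in>qgraut I q. \<forall>i\<in>D. \<phi> (qgen i) \<in> qcarrier D"
  shows "Aut_gr I q \<cong> product_group P (\<lambda>D. Aut_gr D q)"
proof -
  define h :: "(((nat \<Rightarrow> nat) \<Rightarrow> 'k) \<Rightarrow> (nat \<Rightarrow> nat) \<Rightarrow> 'k) \<Rightarrow> _"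
    where "h = (\<lambda>\<phi>. \<lambda>D\<in>P. restrict \<phi> (qcarrier D))"
  have sub: "D \<subseteq> I" if "D \<in> P" for D using that assms(2) by blast
  have subC: "f \<in> qcarrier I" if "f \<in> qcarrier D" "D \<in> P" for f :: "(nat \<Rightarrow> nat) \<Rightarrow> 'k" and D
    using qcarrier_mono[OF sub[OF that(2)]] that(1) by (rule subsetD)
  have h_in: "h \<phi> D \<in> qgraut D q" if "\<phi> \<in> qgraut I q" "D \<in> P" for \<phi> D
    using graut_restrict[OF sub[OF that(2)] that(1) inv[OF that(2)]] that(2) by (simp add: h_def)
  have in_D: "\<phi> f \<in> qcarrier D" if "\<phi> \<in> qgraut I q" "D \<in> P" "f \<in> qcarrier D" for \<phi> D f
    using graut_preserves_subalgebra[OF sub[OF that(2)] that(1) bspec[OF inv[OF that(2)] that(1)] that(3)] .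
  have h_hom: "h (compose (qcarrier I) \<phi> \<psi>) = (\<lambda>D\<in>P. compose (qcarrier D) (h \<phi> D) (h \<psi> D))"
    if "\<phi> \<in> qgraut I q" "\<psi> \<in> qgraut I q" for \<phi> \<psi>
    unfolding h_def
    by (intro restrict_ext) (auto simp: compose_def restrict_def fun_eq_iff subC in_D[OF that(2)])
  have h_inj: "\<phi> = \<psi>" if "\<phi> \<in> qgraut I q" "\<psi> \<in> qgraut I q" "h \<phi> = h \<psi>" for \<phi> \<psi>
  proof (rule graut_eqI[OF that(1,2)])
    fix i assume "i \<in> I"
    then obtain D where D: "D \<in> P" "i \<in> D" using assms(2) by blast
    have "h \<phi> D (qgen i) = h \<psi> D (qgen i)" using that(3) by simp
    then show "\<phi> (qgen i) = \<psi> (qgen i)" using D by (simp add: h_def)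
  qed
  have finP: "finite P" using assms(2) finite_index finite_UnionD by metis
  have h_surj: "\<exists>\<phi>\<in>qgraut I q. h \<phi> = \<Phi>" if "\<Phi> \<in> (\<Pi>\<^sub>E D\<in>P. qgraut D q)" for \<Phi>
  proof -
    have \<Phi>: "\<Phi> D \<in> qgraut D q" if "D \<in> P" for D using that \<open>\<Phi> \<in> _\<close> by auto
    have family: "\<forall>D\<in>P. D \<subseteq> I \<and> D \<noteq> {} \<and> \<Phi> D \<in> qgraut D q \<and> (\<forall>a\<in>D. \<forall>a'\<in>D. \<forall>b\<in>I - D. q a b = q a' b)"
    proof
      fix D assume D: "D \<in> P"
      then have "D \<noteq> {}" using assms(3) by blast
      then show "D \<subseteq> I \<and> D \<noteq> {} \<and> \<Phi> D \<in> qgraut D q \<and> (\<forall>a\<in>D. \<forall>a'\<in>D. \<forall>b\<in>I - D. q a b = q a' b)"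
        using sub[OF D] \<Phi>[OF D] cross[OF D] by (intro conjI)
    qed
    from extend_family[of P \<Phi>, OF finP assms(1) family]
    obtain \<phi> where \<phi>: "\<phi> \<in> qgraut I q" and spec: "(\<forall>D\<in>P. \<forall>f\<in>qcarrier D. \<phi> f = \<Phi> D f) \<and>
        (\<forall>f\<in>qcarrier (I - \<Union>P). \<phi> f = f)" by (rule bexE)
    have "h \<phi> = \<Phi>"
    proof (rule extensionalityI[of _ P])
      show "\<Phi> \<in> extensional P" using that by (simp add: PiE_iff)
      fix D assume D: "D \<in> P"
      show "h \<phi> D = \<Phi> D"
        using D conjunct1[OF spec] graut_extensional[OF \<Phi>[OF D]]
        by (intro extensionalityI[of _ "qcarrier D"]) (simp_all add: h_def)
    qed (simp add: h_def)
    then show ?thesis using \<phi> by (rule bexI)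
  qed
  have "h \<in> hom (Aut_gr I q) (product_group P (\<lambda>D. Aut_gr D q))"
    using h_in h_hom by (auto simp: hom_def Aut_gr_def h_def)
  moreover have "bij_betw h (carrier (Aut_gr I q)) (carrier (product_group P (\<lambda>D. Aut_gr D q)))"
    unfolding bij_betw_def
  proof
    show "inj_on h (carrier (Aut_gr I q))"
      using h_inj by (auto simp: Aut_gr_def intro: inj_onI)
    have "h \<phi> \<in> (\<Pi>\<^sub>E D\<in>P. qgraut D q)" if "\<phi> \<in> qgraut I q" for \<phi>
      using h_in[OF that] by (auto simp: PiE_iff h_def)
    moreover have "\<Phi> \<in> h ` qgraut I q" if "\<Phi> \<in> (\<Pi>\<^sub>E D\<in>P. qgraut D q)" for \<Phi>
      using h_surj[OF that] by (elim bexE) (rule image_eqI[OF sym])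
    ultimately have "h ` qgraut I q = (\<Pi>\<^sub>E D\<in>P. qgraut D q)" by (intro equalityI subsetI) (elim imageE, simp_all)
    then show "h ` carrier (Aut_gr I q) = carrier (product_group P (\<lambda>D. Aut_gr D q))"
      by (simp add: Aut_gr_def)
  qed
  ultimately show ?thesis unfolding is_iso_def iso_def by blast
qed

end

section \<open>The index relation and its classes\<close>

lemma qarrow_refl: "i \<in> {1..n} \<Longrightarrow> qarrow n q i i"
  unfolding qarrow_def by (intro exI[of _ "[i]"]) auto

lemma qarrow_row_perm: "\<lbrakk>i \<in> {1..n}; j \<in> {1..n}; row_perm n q i j\<rbrakk> \<Longrightarrow> qarrow n q i j"
  unfolding qarrow_def by (intro exI[of _ "[i, j]"]) (auto simp: less_Suc_eq)

text \<open>Condition (2) allows a comparison with any earlier entry of the chain, so the new entry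
  is tested against the first one, \<open>t = 0\<close>. Thus a column in which the two end rows
  differ can always be reached.\<close>

lemma qarrow_append:
  assumes "qarrow n q i l" "b \<in> {1..n}" "q l b \<noteq> q i b"
  shows "qarrow n q i b"
proof -
  define step where "step = (\<lambda>xs s. row_perm n q (xs ! (s - 1)) (xs ! s) \<or>
        (\<exists>t<s. q (xs ! (s - 1)) (xs ! s) \<noteq> q (xs ! t) (xs ! s)))"
  have arrow: "qarrow n q i k \<longleftrightarrow> (\<exists>xs. xs \<noteq> [] \<and> hd xs = i \<and> last xs = k \<and> set xs \<subseteq> {1..n} \<and>
      (\<forall>s. 1 \<le> s \<and> s < length xs \<longrightarrow> step xs s))" for k
    by (simp only: qarrow_def step_def)
  obtain xs where xs: "xs \<noteq> []" "hd xs = i" "last xs = l" "set xs \<subseteq> {1..n}"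
    and steps: "\<forall>s. 1 \<le> s \<and> s < length xs \<longrightarrow> step xs s"
    using assms(1) unfolding arrow by (elim exE conjE)
  let ?ys = "xs @ [b]"
  have "step ?ys s" if s: "1 \<le> s" "s < length ?ys" for s
  proof (cases "s < length xs")
    case True
    then have "?ys ! t = xs ! t" if "t \<le> s" for t using that by (simp add: nth_append)
    then have "step ?ys s \<longleftrightarrow> step xs s" unfolding step_def by (simp cong: conj_cong)
    then show ?thesis using steps s True by simp
  next
    case False
    then have s: "s = length xs" using s by simp
    have "?ys ! s = b" "?ys ! (s - 1) = l" "?ys ! 0 = i"
      using xs(1,2,3) last_conv_nth[OF xs(1)] hd_conv_nth[OF xs(1)] by (simp_all add: s nth_append)
    moreover have "0 < s" using xs(1) s by simp
    ultimately have "\<exists>t<s. q (?ys ! (s - 1)) (?ys ! s) \<noteq> q (?ys ! t) (?ys ! s)"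
      using assms(3) by (intro exI[of _ 0]) simp
    then show ?thesis unfolding step_def by (rule disjI2)
  qed
  then show ?thesis
    unfolding arrow using xs assms(2) by (intro exI[of _ ?ys]) simp
qed

definition arrow_sym :: "nat \<Rightarrow> (nat \<Rightarrow> nat \<Rightarrow> 'k) \<Rightarrow> (nat \<times> nat) set" where
  "arrow_sym n q = {(i, l). i \<in> {1..n} \<and> l \<in> {1..n} \<and> (qarrow n q i l \<or> qarrow n q l i)}"

text \<open>Chains with one entry make the arrow reflexive, so the identity part of
  \<open>qR\<close> is already inside the transitive closure.\<close>

lemma qR_eq: "qR n q = (arrow_sym n q)\<^sup>+"
proof -
  have "{(i, l). i \<in> {1..n} \<and> l \<in> {1..n} \<and> qarrow n q i l} \<union>
      {(i, l). i \<in> {1..n} \<and> l \<in> {1..n} \<and> qarrow n q i l}\<inverse> = arrow_sym n q"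
    by (auto simp: arrow_sym_def)
  moreover have "Id_on {1..n} \<subseteq> arrow_sym n q"
    using qarrow_refl[of _ n q] by (auto simp: arrow_sym_def)
  ultimately show ?thesis
    unfolding qR_def Let_def by auto
qed

lemma equiv_qR: "equiv {1..n} (qR n q)"
proof (rule equivI)
  have "arrow_sym n q \<subseteq> {1..n} \<times> {1..n}" by (auto simp: arrow_sym_def)
  then show "qR n q \<subseteq> {1..n} \<times> {1..n}" unfolding qR_eq by (rule trancl_subset_Sigma)
  show "refl_on {1..n} (qR n q)" by (auto simp: refl_on_def qR_def Let_def)
  have "sym (arrow_sym n q)" by (auto simp: sym_def arrow_sym_def)
  then show "sym (qR n q)" unfolding qR_eq by (rule sym_trancl)
  show "trans (qR n q)" unfolding qR_eq by (rule trans_trancl)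
qed

text \<open>If two rows joined by an arrow, in either direction, differed in column
  \<open>b\<close>, then \<open>b\<close> could be appended to the chain and would lie in the class.
  So rows agree in outside columns along each arrow, and induction along the closure
  finishes.\<close>

lemma qR_outside:
  assumes "(x, y) \<in> qR n q" "b \<in> {1..n}" "(x, b) \<notin> qR n q"
  shows "q x b = q y b"
proof -
  have const: "q y b = q z b" if yz: "(y, z) \<in> arrow_sym n q" and xy: "(x, y) \<in> qR n q \<or> x = y" for y z
  proof (rule ccontr)
    assume ne: "q y b \<noteq> q z b"
    have "qarrow n q y b \<or> qarrow n q z b"
      using yz ne assms(2) qarrow_append[of n q y z b] qarrow_append[of n q z y b]
      by (auto simp: arrow_sym_def)
    then have "(y, b) \<in> arrow_sym n q \<or> (z, b) \<in> arrow_sym n q"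
      using yz assms(2) by (auto simp: arrow_sym_def)
    then have "(y, b) \<in> qR n q"
      using yz unfolding qR_eq by (meson r_into_trancl' trancl.trancl_into_trancl)
    then have "(x, b) \<in> qR n q" using xy unfolding qR_eq by (meson trancl_trans)
    then show False using assms(3) by simp
  qed
  from assms(1) have "(x, y) \<in> (arrow_sym n q)\<^sup>+" by (simp only: qR_eq)
  then show ?thesis
  proof (induction rule: trancl_induct)
    case (base y)
    then show ?case using const[of x y] by simp
  next
    case (step y z)
    then show ?case using const[of y z] by (simp add: qR_eq)
  qed
qed

theorem theorem4p2:
  fixes n :: nat and q :: "nat \<Rightarrow> nat \<Rightarrow> 'k::field"
  assumes "qpm n q"
  shows "Aut_gr {1..n} q \<cong> product_group ({1..n} // qR n q) (\<lambda>D. Aut_gr D q)"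
proof -
  interpret quantum_matrix "{1..n}" q
    using assms by unfold_locales (auto simp: qpm_def)
  note eq = equiv_qR[of n q]
  show ?thesis
  proof (rule Aut_gr_iso_product)
    show "disjoint ({1..n} // qR n q)"
      using quotient_disj[OF eq] by (auto simp: disjoint_def pairwise_def disjnt_def)
    show "\<Union> ({1..n} // qR n q) = {1..n}" using eq by (rule Union_quotient)
    show "{} \<notin> {1..n} // qR n q" using in_quotient_imp_non_empty[OF eq] by blast
  next
    fix D
    assume D: "D \<in> {1..n} // qR n q"
    show "\<forall>a\<in>D. \<forall>a'\<in>D. \<forall>b\<in>{1..n} - D. q a b = q a' b"
    proof (intro ballI)
      fix a a' b
      assume a: "a \<in> D" "a' \<in> D" and b: "b \<in> {1..n} - D"
      have "(a, a') \<in> qR n q" using in_quotient_imp_in_rel[OF eq D] a by blast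
      moreover have "(a, b) \<notin> qR n q" using in_quotient_imp_closed[OF eq D a(1)] b by blast
      ultimately show "q a b = q a' b" using b by (intro qR_outside) auto
    qed
  next
    fix D
    assume D: "D \<in> {1..n} // qR n q"
    show "\<forall>\<phi>\<in>qgraut {1..n} q. \<forall>i\<in>D. \<phi> (qgen i) \<in> qcarrier D"
    proof (intro ballI)
      fix \<phi> i
      assume \<phi>: "\<phi> \<in> qgraut {1..n} q" and i: "i \<in> D"
      have iI: "i \<in> {1..n}" using in_quotient_imp_subset[OF eq D] i by blast
      have gen: "qgen i \<in> qcarrier {1..n}" "qhomog {1..n} 1 (qgen i :: (nat \<Rightarrow> nat) \<Rightarrow> 'k)"
        using iI qhomog_qmono[of "{1..n}" "unit_exp i", where 'a = 'k] qdeg_unit_exp[of "{1..n}" i] by simp_all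
      have im: "\<phi> (qgen i) \<in> qcarrier {1..n}" using graut_in_qcarrier[OF \<phi> gen(1)] .
      have "supported_in D c" if c: "\<phi> (qgen i) c \<noteq> 0" for c
      proof -
        obtain a where a: "a \<in> {1..n}" "c = unit_exp a"
          by (rule deg_one_support[of "\<phi> (qgen i)" c, OF im graut_homog[OF \<phi> gen] c])
        have "\<phi> (qgen i) (unit_exp a) \<noteq> 0" using c a(2) by simp
        then obtain p where "p permutes {1..n}" "\<forall>m\<in>{1..n}. q i m = q a (p m)"
          by (rule graut_support_row_perm[of \<phi> i a, OF \<phi> iI a(1)])
        \<comment> \<open>The permutation yields an arrow from \<open>a\<close> to \<open>i\<close>;
          the symmetric closure provides the pair in the other direction.\<close>
        then have "row_perm n q a i" unfolding row_perm_def by (intro exI[of _ p]) auto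
        then have "(i, a) \<in> qR n q"
          unfolding qR_eq using qarrow_row_perm[OF a(1) iI] a(1) iI by (auto simp: arrow_sym_def)
        then show ?thesis using in_quotient_imp_closed[OF eq D i] a by simp
      qed
      then show "\<phi> (qgen i) \<in> qcarrier D" using im by (simp add: qcarrier_iff)
    qed
  qed
qed

end
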